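(* Let $r\in\mathbb N^*$, let $(\rho_n)_{n\ge1}$ be a decreasing sequence of positive numbers, and let $\{\Omega^k_{\rho_n}\}_{(n,k)\in\mathbb N^2,\,1\le k\le n}$ be a family of events in a probability space $(\mathbf\Omega,\mathcal F,\mathbb P)$. Let $N^n_{\rho_n}$ be the number of $k\le n$ such that $\Omega^k_{\rho_n}$ occurs. With $\sigma$ the function appearing in the almost independence conditions (see context), set $$\mathbf S_r=\sum_{j=1}^\infty\left(2^j\sigma(\rho_{2^j})\right)^r .$$ (a) If $\mathbf S_r<\infty$, if the events are nested, i.e. $\Omega^k_{\rho_{n_1}}\subset\Omega^k_{\rho_{n_2}}$ whenever $\rho_{n_1}\le\rho_{n_2}$, and if the family $\{\Omega^k_{\rho_n}\}$ is $2r$-almost independent at a fixed scale, then with probability $1$ we have $N^n_{\rho_n}<r$ for all large $n$. (b) If $\mathbf S_r=\infty$ and the family $\{\Omega^k_{\rho_n}\}$ is $2r$-almost independent at all scales, then with probability $1$ there are infinitely many $n$ such that $N^n_{\rho_n}\ge r$.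
   Context: Data for the conditions: an increasing (nondecreasing) function $\sigma:\mathbb R_+\to\mathbb R_+$; a sequence $\varepsilon_n\to0$; a function $\mathfrak s:\mathbb N\to\mathbb N$ with $\mathfrak s(n)\le(\ln n)^2$; a function $\hat{\mathfrak s}:\mathbb N\to\mathbb N$ with $\varepsilon n\le\hat{\mathfrak s}(n)<n(1-q)/(2r)$ for all sufficiently large $n$, for some $0<q<1$ and $0<\varepsilon<(1-q)/(2r)$. For a tuple $k_1<\dots<k_p\le n$ put $k_0:=0$ and $$\mathrm{Sep}_n(k_1,\dots,k_p)=\mathrm{Card}\{j\in\{0,\dots,p-1\}:k_{j+1}-k_j\ge\mathfrak s(n)\},$$ $$\widehat{\mathrm{Sep}}_n(k_1,\dots,k_p)=\mathrm{Card}\{j\in\{0,\dots,p-1\}:k_{j+1}-k_j\ge\hat{\mathfrak s}(n)\}.$$ Conditions, for an integer $p\ge1$: $(M1)_p$: if $1\le k_1<\dots<k_p\le n$ and $\mathrm{Sep}_n(k_1,\dots,k_p)=p$, then $\sigma(\rho_n)^p(1-\varepsilon_n)\le\mathbb P\big(\bigcap_{j=1}^p\Omega^{k_j}_{\rho_n}\big)\le\sigma(\rho_n)^p(1+\varepsilon_n)$. $(M2)_p$: there is $K>0$ such that if $n\ge 2$, $1\le k_1<\dots<k_p\le n$ and $\mathrm{Sep}_n(k_1,\dots,k_p)=m<p$, then $\mathbb P\big(\bigcap_{j=1}^p\Omega^{k_j}_{\rho_n}\big)\le\dfrac{K\sigma(\rho_n)^m}{(\ln n)^{100p}}$. $(M3)_p$: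 there is a constant $b\ge1$ such that if $k_1<\dots<k_p<l_1<\dots<l_p$ satisfy $2^i<k_\alpha\le2^{i+1}$ and $2^j<l_\beta\le2^{j+1}$ for $1\le\alpha,\beta\le p$, with $j-i\ge b$, $\widehat{\mathrm{Sep}}_{2^{i+1}}(k_1,\dots,k_p)=p$, $\widehat{\mathrm{Sep}}_{2^{j+1}}(l_1,\dots,l_p)=p$ and $l_1-k_p\ge\hat{\mathfrak s}(2^{j+1})$, then $$\mathbb P\Big(\Big[\bigcap_{\alpha=1}^p\Omega^{k_\alpha}_{\rho_{2^{i+1}}}\Big]\cap\Big[\bigcap_{\beta=1}^p\Omega^{l_\beta}_{\rho_{2^{j+1}}}\Big]\Big)\le\sigma(\rho_{2^{i+1}})^p\,\sigma(\rho_{2^{j+1}})^p(1+\varepsilon_i).$$ The family is $2r$-almost independent at a fixed scale if $(M1)_{\bar r}$ and $(M2)_{\bar r}$ hold for every integer $\bar r\in[1,2r]$ (with one and the same choice of the function $\sigma$, the sequence $(\varepsilon_n)$ and the functions $\mathfrak s$ and $\hat{\mathfrak s}$ for all $\bar r$). It is $2r$-almost independent at all scales if moreover $(M3)_{\bar r}$ holds for every integer $\bar r\in[1,r]$. *)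

theory Defs
  imports "HOL-Probability.Probability"
begin

text \<open>The family of events is indexed as \<open>Om n k\<close> for the event at scale \<open>\<rho> n\<close> and time \<open>k\<close>;
  only the values with \<open>1 \<le> k \<le> n\<close> matter.\<close>

definition is_event_family :: "'a measure \<Rightarrow> (nat \<Rightarrow> nat \<Rightarrow> 'a set) \<Rightarrow> bool" where
  "is_event_family M Om \<longleftrightarrow> (\<forall>n k. 1 \<le> k \<and> k \<le> n \<longrightarrow> Om n k \<in> sets M)"

definition nested_events :: "(nat \<Rightarrow> real) \<Rightarrow> (nat \<Rightarrow> nat \<Rightarrow> 'a set) \<Rightarrow> bool" where
  "nested_events \<rho> Om \<longleftrightarrow>
     (\<forall>n1 n2 k. 1 \<le> k \<and> k \<le> n1 \<and> k \<le> n2 \<and> \<rho> n1 \<le> \<rho> n2 \<longrightarrow> Om n1 k \<subseteq> Om n2 k)"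

definition num_events :: "(nat \<Rightarrow> nat \<Rightarrow> 'a set) \<Rightarrow> nat \<Rightarrow> 'a \<Rightarrow> nat" where
  "num_events Om n \<omega> = card {k \<in> {1..n}. \<omega> \<in> Om n k}"

text \<open>The index \<open>Suc j\<close> makes the series start at 1. The summands are nonnegative
  whenever \<open>\<sigma>\<close> is, so the truncation in \<open>ennreal\<close> has no effect.\<close>

definition S_sum :: "nat \<Rightarrow> (real \<Rightarrow> real) \<Rightarrow> (nat \<Rightarrow> real) \<Rightarrow> ennreal" where
  "S_sum r \<sigma> \<rho> = (\<Sum>j. ennreal ((2 ^ Suc j * \<sigma> (\<rho> (2 ^ Suc j))) ^ r))"

definition independence_data ::
  "nat \<Rightarrow> (real \<Rightarrow> real) \<Rightarrow> (nat \<Rightarrow> real) \<Rightarrow> (nat \<Rightarrow> nat) \<Rightarrow> (nat \<Rightarrow> nat) \<Rightarrow> bool" where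
  "independence_data r \<sigma> \<epsilon> s sh \<longleftrightarrow>
     (\<forall>x\<ge>0. 0 \<le> \<sigma> x) \<and> mono_on {0..} \<sigma> \<and>
     \<epsilon> \<longlonglongrightarrow> 0 \<and>
     (\<forall>n\<ge>1. real (s n) \<le> (ln (real n))\<^sup>2) \<and>
     (\<exists>q e. 0 < q \<and> q < 1 \<and> 0 < e \<and> e < (1 - q) / (2 * real r) \<and>
        (\<forall>\<^sub>F n in sequentially.
           e * real n \<le> real (sh n) \<and> real (sh n) < real n * (1 - q) / (2 * real r)))"

text \<open>A tuple \<open>1 \<le> k\<^sub>1 < \<dots> < k\<^sub>p\<close> is a function whose values at \<open>1, \<dots>, p\<close> are the entries
  and whose value at \<open>0\<close> is the convention \<open>k\<^sub>0 = 0\<close>; values beyond \<open>p\<close> are irrelevant.\<close>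

definition incr_tuple :: "nat \<Rightarrow> (nat \<Rightarrow> nat) \<Rightarrow> bool" where
  "incr_tuple p k \<longleftrightarrow> k 0 = 0 \<and> strict_mono_on {0..p} k"

text \<open>Number of gaps of length at least \<open>s n\<close>; used with both separation functions.\<close>

definition Sep :: "(nat \<Rightarrow> nat) \<Rightarrow> nat \<Rightarrow> nat \<Rightarrow> (nat \<Rightarrow> nat) \<Rightarrow> nat" where
  "Sep s n p k = card {j \<in> {0..<p}. k (Suc j) - k j \<ge> s n}"

definition M1 ::
  "'a measure \<Rightarrow> (nat \<Rightarrow> nat \<Rightarrow> 'a set) \<Rightarrow> (nat \<Rightarrow> real) \<Rightarrow>
   (real \<Rightarrow> real) \<Rightarrow> (nat \<Rightarrow> real) \<Rightarrow> (nat \<Rightarrow> nat) \<Rightarrow> nat \<Rightarrow> bool" where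
  "M1 M Om \<rho> \<sigma> \<epsilon> s p \<longleftrightarrow>
     (\<forall>n k. incr_tuple p k \<and> k p \<le> n \<and> Sep s n p k = p \<longrightarrow>
        \<sigma> (\<rho> n) ^ p * (1 - \<epsilon> n) \<le> measure M (\<Inter>j\<in>{1..p}. Om n (k j)) \<and>
        measure M (\<Inter>j\<in>{1..p}. Om n (k j)) \<le> \<sigma> (\<rho> n) ^ p * (1 + \<epsilon> n))"

definition M2 ::
  "'a measure \<Rightarrow> (nat \<Rightarrow> nat \<Rightarrow> 'a set) \<Rightarrow> (nat \<Rightarrow> real) \<Rightarrow>
   (real \<Rightarrow> real) \<Rightarrow> (nat \<Rightarrow> nat) \<Rightarrow> nat \<Rightarrow> bool" where
  "M2 M Om \<rho> \<sigma> s p \<longleftrightarrow>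
     (\<exists>K>0. \<forall>n k m. 2 \<le> n \<and> incr_tuple p k \<and> k p \<le> n \<and> Sep s n p k = m \<and> m < p \<longrightarrow>
        measure M (\<Inter>j\<in>{1..p}. Om n (k j)) \<le> K * \<sigma> (\<rho> n) ^ m / (ln (real n)) ^ (100 * p))"

definition M3 ::
  "'a measure \<Rightarrow> (nat \<Rightarrow> nat \<Rightarrow> 'a set) \<Rightarrow> (nat \<Rightarrow> real) \<Rightarrow>
   (real \<Rightarrow> real) \<Rightarrow> (nat \<Rightarrow> real) \<Rightarrow> (nat \<Rightarrow> nat) \<Rightarrow> nat \<Rightarrow> bool" where
  "M3 M Om \<rho> \<sigma> \<epsilon> sh p \<longleftrightarrow>
     (\<exists>b\<ge>1. \<forall>i j k l.
        incr_tuple p k \<and> incr_tuple p l \<and> k p < l 1 \<and>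
        (\<forall>\<alpha>\<in>{1..p}. 2 ^ i < k \<alpha> \<and> k \<alpha> \<le> 2 ^ (i + 1)) \<and>
        (\<forall>\<beta>\<in>{1..p}. 2 ^ j < l \<beta> \<and> l \<beta> \<le> 2 ^ (j + 1)) \<and>
        i + b \<le> j \<and>
        Sep sh (2 ^ (i + 1)) p k = p \<and> Sep sh (2 ^ (j + 1)) p l = p \<and>
        sh (2 ^ (j + 1)) \<le> l 1 - k p \<longrightarrow>
        measure M ((\<Inter>\<alpha>\<in>{1..p}. Om (2 ^ (i + 1)) (k \<alpha>)) \<inter> (\<Inter>\<beta>\<in>{1..p}. Om (2 ^ (j + 1)) (l \<beta>)))
          \<le> \<sigma> (\<rho> (2 ^ (i + 1))) ^ p * \<sigma> (\<rho> (2 ^ (j + 1))) ^ p * (1 + \<epsilon> i))"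

text \<open>In the next two predicates the parameter is \<open>r\<close>, and the property is
  \<open>2r\<close>-almost independence.\<close>

definition almost_indep_fixed_scale ::
  "'a measure \<Rightarrow> (nat \<Rightarrow> nat \<Rightarrow> 'a set) \<Rightarrow> (nat \<Rightarrow> real) \<Rightarrow> nat \<Rightarrow>
   (real \<Rightarrow> real) \<Rightarrow> (nat \<Rightarrow> real) \<Rightarrow> (nat \<Rightarrow> nat) \<Rightarrow> (nat \<Rightarrow> nat) \<Rightarrow> bool" where
  "almost_indep_fixed_scale M Om \<rho> r \<sigma> \<epsilon> s sh \<longleftrightarrow>
     independence_data r \<sigma> \<epsilon> s sh \<and>
     (\<forall>p\<in>{1..2 * r}. M1 M Om \<rho> \<sigma> \<epsilon> s p \<and> M2 M Om \<rho> \<sigma> s p)"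

definition almost_indep_all_scales ::
  "'a measure \<Rightarrow> (nat \<Rightarrow> nat \<Rightarrow> 'a set) \<Rightarrow> (nat \<Rightarrow> real) \<Rightarrow> nat \<Rightarrow>
   (real \<Rightarrow> real) \<Rightarrow> (nat \<Rightarrow> real) \<Rightarrow> (nat \<Rightarrow> nat) \<Rightarrow> (nat \<Rightarrow> nat) \<Rightarrow> bool" where
  "almost_indep_all_scales M Om \<rho> r \<sigma> \<epsilon> s sh \<longleftrightarrow>
     almost_indep_fixed_scale M Om \<rho> r \<sigma> \<epsilon> s sh \<and>
     (\<forall>p\<in>{1..r}. M3 M Om \<rho> \<sigma> \<epsilon> sh p)"

end

theory Submission
  imports Defs "HOL-Real_Asymp.Real_Asymp"
begin

text \<open>Write \<open>v n = \<sigma> (\<rho> n)\<close>. Because \<open>\<sigma>\<close> is increasing and \<open>\<rho>\<close> decreasing, \<open>v\<close> decreases.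
Heuristically the events at scale \<open>n\<close> are independent with probability \<open>v n\<close>, so \<open>r\<close> of them occur
together with probability about \<open>(n * v n) ^ r\<close>; along dyadic scales these numbers are the terms of
the series, and the theorem is a Borel--Cantelli dichotomy for it.

The conditions on separated and on clustered tuples combine into a single estimate
(\<open>prob_tuple_le\<close>): the probability of a tuple at scale \<open>n\<close> is at most a constant times a product
over its gaps, where a gap of length at least \<open>s n\<close> contributes \<open>v n\<close> and a shorter one contributes
\<open>1 / ln n ^ 4\<close>. The product form lets sums over tuples factorise into sums over single gaps. A short gap
has at most \<open>(ln n)\<^sup>2\<close> possible values, so the short gaps add only \<open>1 / (ln n)\<^sup>2\<close> to such a sum,
which is summable along \<open>n = 2 ^ j\<close>.

Convergent series. If \<open>2 ^ j \<le> n < 2 ^ Suc j\<close> and \<open>r\<close> events \<open>Om n k\<^sub>1, \<dots>, Om n k\<^sub>r\<close> occur, nestedness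
moves them to the scale \<open>max k\<^sub>r (2 ^ j)\<close>. One cannot move them to \<open>2 ^ j\<close> itself, since \<open>Om m k\<close> is
meaningful only for \<open>k \<le> m\<close>; the chosen scale depends on the tuple but not on \<open>n\<close>, and \<open>v\<close> is at most
\<open>v (2 ^ j)\<close> there. The union bound over tuples (\<open>prob_block_event_le\<close>) gives a summable bound for the
whole dyadic block, and the first Borel--Cantelli lemma applies.

Divergent series. Inside \<open>(2 ^ i, 2 ^ Suc i]\<close> place \<open>r\<close> windows of common width \<open>w\<close>, separated by
\<open>sh\<close>, and count the tuples that have one entry in each window and all of whose events occur. The width
is a fixed fraction of the block, cut down to about \<open>1 / v\<close>, so that \<open>u = w * v\<close> stays bounded while
\<open>u ^ r\<close> still has a divergent sum (\<open>expected_hits_not_summable\<close>). The count has mean about \<open>u ^ r\<close>;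
its second moment is at most a constant times \<open>u ^ r\<close> because a pair of tuples is a union of \<open>r\<close> pairs
in separate windows and the product bound factorises over the windows (\<open>second_moment_hits\<close>); counts
at distant scales are asymptotically uncorrelated from above (\<open>prob_hit_two_scales\<close>). Chebyshev's
inequality, in the form of \<open>second_moment_Borel_Cantelli\<close>, then makes infinitely many counts positive.\<close>


section \<open>Infinitely many positive counts from second moments\<close>

text \<open>Let \<open>Z\<close> be a long sum of the \<open>X i\<close> that starts late. Pairs at distance at least \<open>b\<close> contribute at most
\<open>(1 + \<delta>)\<close> times what independence would give, and the few close pairs contribute only \<open>O(E Z)\<close>, by
\<open>x * y \<le> x\<^sup>2 + y\<^sup>2\<close> and the bound on the diagonal. So \<open>Var Z \<le> \<delta> (E Z)\<^sup>2 + O(E Z)\<close>, and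
as \<open>E Z\<close> is unbounded, Chebyshev's inequality makes \<open>Z = 0\<close> improbable, however late the sum starts.\<close>

lemma (in prob_space) second_moment_Borel_Cantelli:
  fixes X :: "nat \<Rightarrow> 'a \<Rightarrow> real" and C :: real and b :: nat
  assumes intX: "\<And>i. integrable M (X i)"
    and intXX: "\<And>i j. integrable M (\<lambda>\<omega>. X i \<omega> * X j \<omega>)"
    and nonneg: "\<And>i \<omega>. 0 \<le> X i \<omega>"
    and diag: "\<forall>\<^sub>F i in sequentially. expectation (\<lambda>\<omega>. X i \<omega> * X i \<omega>) \<le> C * expectation (X i)"
    and far: "\<And>\<delta>. 0 < \<delta> \<Longrightarrow> \<forall>\<^sub>F i in sequentially. \<forall>j\<ge>i + b.
        expectation (\<lambda>\<omega>. X i \<omega> * X j \<omega>) \<le> (1 + \<delta>) * (expectation (X i) * expectation (X j))"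
    and diverges: "\<not> summable (\<lambda>i. expectation (X i))"
  shows "AE \<omega> in M. \<exists>\<^sub>\<infinity>i. 0 < X i \<omega>"
proof -
  define e where "e = (\<lambda>i. expectation (X i))"
  have e0: "0 \<le> e i" for i
    unfolding e_def by (rule integral_nonneg_AE) (simp add: nonneg)
  have [measurable]: "X i \<in> borel_measurable M" for i
    using intX by auto
  define G where "G = (\<lambda>m. {\<omega> \<in> space M. \<exists>i\<ge>m. 0 < X i \<omega>})"
  have G_sets [measurable]: "G m \<in> sets M" for m
    unfolding G_def by measurable
  have nearly: "1 - 2 * \<delta> \<le> prob (G m)" if \<delta>: "0 < \<delta>" for \<delta> m
  proof -
    obtain i0 where i0: "m \<le> i0"
      and diag': "\<And>i. i0 \<le> i \<Longrightarrow> expectation (\<lambda>\<omega>. X i \<omega> * X i \<omega>) \<le> C * e i"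
      and far': "\<And>i j. i0 \<le> i \<Longrightarrow> i + b \<le> j \<Longrightarrow>
          expectation (\<lambda>\<omega>. X i \<omega> * X j \<omega>) \<le> (1 + \<delta>) * (e i * e j)"
    proof -
      have "\<forall>\<^sub>F i in sequentially. m \<le> i \<and> expectation (\<lambda>\<omega>. X i \<omega> * X i \<omega>) \<le> C * e i \<and>
          (\<forall>j\<ge>i + b. expectation (\<lambda>\<omega>. X i \<omega> * X j \<omega>) \<le> (1 + \<delta>) * (e i * e j))"
        using diag far[OF \<delta>] unfolding e_def by (auto intro!: eventually_conj eventually_ge_at_top)
      then show ?thesis
        using that unfolding eventually_sequentially by blast
    qed
    define near where "near = (\<lambda>i j. i < j + b \<and> j < i + b)"
    define D where "D = \<bar>C\<bar>"
    have pair: "expectation (\<lambda>\<omega>. X i \<omega> * X j \<omega>)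
        \<le> (1 + \<delta>) * (e i * e j) + (if near i j then D * (e i + e j) else 0)"
      if "i0 \<le> i" "i0 \<le> j" for i j
    proof (cases "near i j")
      case True
      have "expectation (\<lambda>\<omega>. X i \<omega> * X j \<omega>)
          \<le> expectation (\<lambda>\<omega>. X i \<omega> * X i \<omega> + X j \<omega> * X j \<omega>)"
      proof (rule integral_mono)
        fix \<omega>
        have "0 \<le> (X i \<omega> - X j \<omega>)\<^sup>2" by simp
        then show "X i \<omega> * X j \<omega> \<le> X i \<omega> * X i \<omega> + X j \<omega> * X j \<omega>"
          using mult_nonneg_nonneg[OF nonneg nonneg, of i \<omega> j \<omega>]
          by (simp add: power2_eq_square algebra_simps)
      qed (auto intro!: intXX Bochner_Integration.integrable_add)
      also have "\<dots> = expectation (\<lambda>\<omega>. X i \<omega> * X i \<omega>) + expectation (\<lambda>\<omega>. X j \<omega> * X j \<omega>)"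
        by (simp add: intXX)
      also have "\<dots> \<le> C * e i + C * e j"
        using diag' that by (intro add_mono) auto
      also have "\<dots> \<le> D * (e i + e j)"
        using e0 unfolding D_def by (simp add: distrib_left add_mono mult_right_mono)
      finally show ?thesis
        using True \<delta> e0[of i] e0[of j]
        by (smt (verit) mult_nonneg_nonneg)
    next
      case False
      then consider "i + b \<le> j" | "j + b \<le> i"
        unfolding near_def by linarith
      then show ?thesis
      proof cases
        case 1
        then show ?thesis using far'[OF that(1), of j] False by simp
      next
        case 2
        then show ?thesis using far'[OF that(2), of i] False by (simp add: mult.commute)
      qed
    qed
    have near_sum: "(\<Sum>i=i0..<n. \<Sum>j=i0..<n. if near i j then e i else 0) \<le> 2 * b * (\<Sum>i=i0..<n. e i)" for n
    proof -
      have "(\<Sum>j=i0..<n. if near i j then e i else 0) \<le> 2 * b * e i" for i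
      proof -
        have "(\<Sum>j=i0..<n. if near i j then e i else 0) = card {j \<in> {i0..<n}. near i j} * e i"
          by (simp flip: sum.inter_filter)
        also have "\<dots> \<le> card {i - b..<i + b} * e i"
          using e0[of i] by (intro mult_right_mono of_nat_mono card_mono) (auto simp: near_def)
        also have "\<dots> \<le> (2 * b) * e i"
          using e0[of i] by (intro mult_right_mono of_nat_mono) auto
        finally show ?thesis by simp
      qed
      then show ?thesis
        unfolding sum_distrib_left by (intro sum_mono)
    qed
    have near_sum': "(\<Sum>i=i0..<n. \<Sum>j=i0..<n. if near i j then e j else 0) \<le> 2 * b * (\<Sum>i=i0..<n. e i)" for n
      using near_sum[of n] by (subst sum.swap) (simp add: near_def conj_commute)
    define Z where "Z = (\<lambda>n \<omega>. \<Sum>i=i0..<n. X i \<omega>)"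
    define E where "E = (\<lambda>n. \<Sum>i=i0..<n. e i)"
    have [measurable]: "Z n \<in> borel_measurable M" for n
      unfolding Z_def by measurable
    have intZ: "integrable M (Z n)" for n
      unfolding Z_def by (simp add: intX)
    have Zsq: "(Z n \<omega>)\<^sup>2 = (\<Sum>i=i0..<n. \<Sum>j=i0..<n. X i \<omega> * X j \<omega>)" for n \<omega>
      unfolding Z_def by (simp add: power2_eq_square sum_product)
    have intZ2: "integrable M (\<lambda>\<omega>. (Z n \<omega>)\<^sup>2)" for n
      unfolding Zsq by (simp add: intXX)
    have EZ: "expectation (Z n) = E n" for n
      unfolding Z_def E_def e_def by (simp add: intX)
    have EZ2: "expectation (\<lambda>\<omega>. (Z n \<omega>)\<^sup>2) \<le> (1 + \<delta>) * (E n)\<^sup>2 + 4 * b * D * E n" for n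
    proof -
      have "expectation (\<lambda>\<omega>. (Z n \<omega>)\<^sup>2)
          = (\<Sum>i=i0..<n. \<Sum>j=i0..<n. expectation (\<lambda>\<omega>. X i \<omega> * X j \<omega>))"
        unfolding Zsq by (simp add: intXX)
      also have "\<dots> \<le> (\<Sum>i=i0..<n. \<Sum>j=i0..<n. (1 + \<delta>) * (e i * e j)
          + (D * (if near i j then e i else 0) + D * (if near i j then e j else 0)))"
      proof (intro sum_mono)
        fix i j assume "i \<in> {i0..<n}" "j \<in> {i0..<n}"
        then show "expectation (\<lambda>\<omega>. X i \<omega> * X j \<omega>) \<le> (1 + \<delta>) * (e i * e j)
            + (D * (if near i j then e i else 0) + D * (if near i j then e j else 0))"
          using pair[of i j] by (cases "near i j") (simp_all add: distrib_left)
      qed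
      also have "\<dots> = (1 + \<delta>) * (E n)\<^sup>2
          + (D * (\<Sum>i=i0..<n. \<Sum>j=i0..<n. if near i j then e i else 0)
           + D * (\<Sum>i=i0..<n. \<Sum>j=i0..<n. if near i j then e j else 0))"
        unfolding E_def by (simp only: power2_eq_square sum_product) (simp only: sum.distrib sum_distrib_left)
      also have "\<dots> \<le> (1 + \<delta>) * (E n)\<^sup>2 + (D * (2 * b * E n) + D * (2 * b * E n))"
        using near_sum[of n] near_sum'[of n] unfolding E_def D_def
        by (intro add_mono mult_left_mono order_refl) auto
      finally show ?thesis by (simp add: algebra_simps)
    qed
    \<comment> \<open>For such \<open>n\<close> the contribution of the close pairs is at most \<open>\<delta>\<close> times the squared mean.\<close>
    obtain n where En: "0 < E n" "4 * b * D / \<delta> \<le> E n"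
    proof -
      have "\<not> summable (\<lambda>i. e (i + i0))"
        using diverges unfolding e_def by (subst summable_iff_shift)
      moreover have "0 \<le> e (i + i0)" for i by (rule e0)
      ultimately have "\<not> (\<forall>n. (\<Sum>i<n. e (i + i0)) \<le> 1 + 4 * b * D / \<delta>)"
        using bounded_imp_summable[of "\<lambda>i. e (i + i0)" "1 + 4 * b * D / \<delta>"]
        by (metis lessThan_Suc_atMost)
      then obtain n where "1 + 4 * b * D / \<delta> < (\<Sum>i<n. e (i + i0))"
        by (auto simp: not_le)
      also have "\<dots> = E (n + i0)"
        unfolding E_def using sum.shift_bounds_nat_ivl[of e 0 i0 n] by (simp add: lessThan_atLeast0)
      finally have "1 + 4 * b * D / \<delta> < E (n + i0)" .
      moreover have "0 \<le> 4 * b * D / \<delta>" using \<delta> by (simp add: D_def)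
      ultimately show ?thesis by (intro that[of "n + i0"]) linarith+
    qed
    have var: "variance (Z n) \<le> 2 * \<delta> * (E n)\<^sup>2"
    proof -
      have "4 * b * D \<le> \<delta> * E n"
        using En(2) \<delta> by (simp add: field_simps)
      then have "4 * b * D * E n \<le> \<delta> * E n * E n"
        using En(1) by (intro mult_right_mono) auto
      moreover have "variance (Z n) = expectation (\<lambda>\<omega>. (Z n \<omega>)\<^sup>2) - (E n)\<^sup>2"
        using variance_eq[OF intZ intZ2] EZ by simp
      ultimately show ?thesis
        using EZ2[of n] by (simp add: power2_eq_square algebra_simps)
    qed
    have "prob (space M - G m) \<le> prob {\<omega> \<in> space M. E n \<le> \<bar>Z n \<omega> - expectation (Z n)\<bar>}"
    proof (rule finite_measure_mono)
      show "space M - G m \<subseteq> {\<omega> \<in> space M. E n \<le> \<bar>Z n \<omega> - expectation (Z n)\<bar>}"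
      proof
        fix \<omega> assume \<omega>: "\<omega> \<in> space M - G m"
        then have "X i \<omega> = 0" if "m \<le> i" for i
          using that nonneg[of i \<omega>] unfolding G_def by force
        then have "Z n \<omega> = 0"
          unfolding Z_def using i0 by (intro sum.neutral) auto
        then show "\<omega> \<in> {\<omega> \<in> space M. E n \<le> \<bar>Z n \<omega> - expectation (Z n)\<bar>}"
          using \<omega> En(1) EZ by simp
      qed
    qed measurable
    also have "\<dots> \<le> variance (Z n) / (E n)\<^sup>2"
      by (rule Chebyshev_inequality) (use intZ2 En in auto)
    also have "\<dots> \<le> 2 * \<delta>"
      using var En(1) by (simp add: divide_le_eq)
    finally show ?thesis
      by (simp add: prob_compl)
  qed
  have "prob (G m) = 1" for m
  proof (rule antisym)
    show "1 \<le> prob (G m)"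
    proof (rule field_le_epsilon)
      fix \<delta> :: real assume "0 < \<delta>"
      then show "1 \<le> prob (G m) + \<delta>" using nearly[of "\<delta> / 2" m] by simp
    qed
  qed simp
  then have "AE \<omega> in M. \<forall>m. \<omega> \<in> G m"
    using prob_eq_1[OF G_sets] by (simp add: AE_all_countable)
  then show ?thesis
    unfolding G_def INFM_nat_le by eventually_elim blast
qed

lemma (in prob_space) integrable_count:
  assumes "\<And>k. k \<in> T \<Longrightarrow> E k \<in> sets M"
  shows "integrable M (\<lambda>\<omega>. \<Sum>k\<in>T. indicator (E k) \<omega> :: real)"
  using assms by (intro Bochner_Integration.integrable_sum integrable_real_indicator)
    (simp_all add: emeasure_eq_measure)

lemma (in prob_space) expectation_count:
  assumes "\<And>k. k \<in> T \<Longrightarrow> E k \<in> sets M"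
  shows "expectation (\<lambda>\<omega>. \<Sum>k\<in>T. indicator (E k) \<omega>) = (\<Sum>k\<in>T. prob (E k))"
proof -
  have "expectation (\<lambda>\<omega>. \<Sum>k\<in>T. indicator (E k) \<omega>) = (\<Sum>k\<in>T. expectation (indicator (E k) :: 'a \<Rightarrow> real))"
    using assms by (intro Bochner_Integration.integral_sum integrable_real_indicator)
      (simp_all add: emeasure_eq_measure)
  also have "\<dots> = (\<Sum>k\<in>T. prob (E k))"
    using assms by (intro sum.cong) (simp_all add: Int_absorb2 sets.sets_into_space)
  finally show ?thesis .
qed

lemma count_mult_count:
  fixes E :: "'k \<Rightarrow> 'a set" and F :: "'l \<Rightarrow> 'a set"
  shows "(\<Sum>k\<in>S. indicator (E k) \<omega>) * (\<Sum>l\<in>T. indicator (F l) \<omega>)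
    = (\<Sum>(k, l)\<in>S \<times> T. indicator (E k \<inter> F l) \<omega> :: real)"
  by (simp add: sum_product sum.cartesian_product indicator_inter_arith)

section \<open>Tuples, gaps and sets\<close>

text \<open>For a finite set of times, the set-theoretic counterpart of ``the gap ending at \<open>x\<close> is at least \<open>d\<close>'';
the time \<open>0\<close> is included to match the convention for the first gap of a tuple. Sets are more convenient
than tuples when two tuples have to be merged.\<close>

definition left_isolated :: "nat \<Rightarrow> nat set \<Rightarrow> nat \<Rightarrow> bool" where
  "left_isolated d U x \<longleftrightarrow> (\<forall>y\<in>insert 0 U. y < x \<longrightarrow> d \<le> x - y)"

lemma incr_tuple_less:
  assumes "incr_tuple p k" "i < j" "j \<le> p"
  shows "k i < k j"
  using assms strict_mono_onD[of "{0..p}" k i j] unfolding incr_tuple_def by simp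

lemma incr_tuple_le:
  assumes "incr_tuple p k" "i \<le> j" "j \<le> p"
  shows "k i \<le> k j"
  using incr_tuple_less[of p k i j] assms by (cases "i = j") auto

lemma incr_tuple_inj:
  assumes "incr_tuple p k"
  shows "inj_on k {0..p}"
  using assms strict_mono_on_imp_inj_on unfolding incr_tuple_def by blast

text \<open>Enumerating \<open>insert 0 U\<close> increasingly from index 0 produces both the entries and the convention for the
value at index 0 at once.\<close>

lemma ex_incr_tuple_enumerating:
  assumes "finite U" "0 \<notin> U"
  obtains k where "incr_tuple (card U) k" "k ` {1..card U} = U"
proof -
  have fin: "finite (insert 0 U)" using assms(1) by simp
  obtain h where h: "bij_betw h {..<card (insert 0 U)} (insert 0 U)"
      "strict_mono_on {..<card (insert 0 U)} h"
    by (rule ex_bij_betw_strict_mono_card[OF fin])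
  have range: "{..<card (insert 0 U)} = {0..card U}"
    using assms by (simp add: lessThan_Suc_atMost atMost_atLeast0)
  have img: "h ` {0..card U} = insert 0 U"
    using h(1) unfolding range by (auto simp: bij_betw_def)
  have h0: "h 0 = 0"
  proof -
    obtain i where i: "i \<in> {0..card U}" "h i = 0"
    proof -
      have "0 \<in> h ` {0..card U}" unfolding img by simp
      then show ?thesis using that by auto
    qed
    show ?thesis
    proof (cases "i = 0")
      case False
      then have "h 0 < h i"
        using strict_mono_onD[of "{0..card U}" h 0 i] h(2) i(1) unfolding range by simp
      then show ?thesis using i by simp
    qed (use i in simp)
  qed
  have inc: "incr_tuple (card U) h"
    using h(2) h0 unfolding incr_tuple_def range by simp
  have "{0..card U} = insert 0 {1..card U}" by auto
  then have "insert 0 (h ` {1..card U}) = insert 0 U"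
    using img h0 by simp
  moreover have notin: "0 \<notin> h ` {1..card U}"
  proof
    assume "0 \<in> h ` {1..card U}"
    then obtain i where "1 \<le> i" "i \<le> card U" "h i = 0" by auto
    then show False using incr_tuple_less[OF inc, of 0 i] h0 by simp
  qed
  ultimately have "h ` {1..card U} = U"
    using insert_ident[OF notin assms(2)] by simp
  with inc show ?thesis by (rule that)
qed

lemma left_isolated_incr_tuple:
  assumes k: "incr_tuple p k" and j: "j < p"
  shows "left_isolated d (k ` {1..p}) (k (Suc j)) \<longleftrightarrow> d \<le> k (Suc j) - k j"
proof
  have k0: "k 0 = 0" using k by (simp add: incr_tuple_def)
  have mem: "k i \<in> insert 0 (k ` {1..p})" if "i \<le> p" for i
    
  proof (cases "i = 0")
    case False
    then have "i \<in> {1..p}" using that by simp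
    then show ?thesis by blast
  qed (simp add: k0)
  {
    assume iso: "left_isolated d (k ` {1..p}) (k (Suc j))"
    have "k j \<in> insert 0 (k ` {1..p})" using j by (intro mem) simp
    moreover have "k j < k (Suc j)" using j by (intro incr_tuple_less[OF k]) simp_all
    ultimately show "d \<le> k (Suc j) - k j"
      using iso unfolding left_isolated_def by blast
  }
  assume gap: "d \<le> k (Suc j) - k j"
  show "left_isolated d (k ` {1..p}) (k (Suc j))"
    unfolding left_isolated_def
  proof (intro ballI impI)
    fix y assume y: "y \<in> insert 0 (k ` {1..p})" and less: "y < k (Suc j)"
    obtain i where i: "i \<le> p" "y = k i"
    proof (cases "y = 0")
      case True
      then show ?thesis using k0 by (intro that[of 0]) simp_all
    next
      case False
      then show ?thesis using y that by auto
    qed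
    have "\<not> Suc j \<le> i"
    proof
      assume "Suc j \<le> i"
      then have "k (Suc j) \<le> k i" using i by (intro incr_tuple_le[OF k]) simp_all
      then show False using less i by simp
    qed
    then have "k i \<le> k j"
      using j by (intro incr_tuple_le[OF k]) simp_all
    then show "d \<le> k (Suc j) - y" using gap i by simp
  qed
qed

lemma Sep_le: "Sep s n p k \<le> p"
proof -
  have "card {j \<in> {0..<p}. k (Suc j) - k j \<ge> s n} \<le> card {0..<p}"
    by (rule card_mono) auto
  then show ?thesis unfolding Sep_def by simp
qed

lemma Sep_eq_iff: "Sep s n p k = p \<longleftrightarrow> (\<forall>j<p. s n \<le> k (Suc j) - k j)"
proof -
  define B where "B = {j \<in> {0..<p}. s n \<le> k (Suc j) - k j}"
  have sub: "B \<subseteq> {0..<p}" unfolding B_def by blast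
  have "card B = p \<longleftrightarrow> B = {0..<p}"
  proof
    assume "card B = p"
    then show "B = {0..<p}" using sub by (intro card_subset_eq) simp_all
  qed simp
  also have "\<dots> \<longleftrightarrow> (\<forall>j\<in>{0..<p}. s n \<le> k (Suc j) - k j)"
    unfolding B_def by blast
  also have "\<dots> \<longleftrightarrow> (\<forall>j<p. s n \<le> k (Suc j) - k j)"
    unfolding Ball_def atLeastLessThan_iff by (simp only: le0 simp_thms)
  finally show ?thesis
    unfolding Sep_def B_def .
qed

text \<open>Recovers a tuple from its gaps, so that a sum over tuples becomes a sum over a product set.\<close>

definition partial_sum :: "(nat \<Rightarrow> nat) \<Rightarrow> nat \<Rightarrow> nat" where
  "partial_sum g i = (\<Sum>t<i. g t)"

lemma partial_sum_Suc: "partial_sum g (Suc i) = partial_sum g i + g i"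
  by (simp add: partial_sum_def)

lemma incr_tuple_partial_sum:
  assumes "\<And>t. t < p \<Longrightarrow> 1 \<le> g t"
  shows "incr_tuple p (partial_sum g)"
proof -
  have "partial_sum g i < partial_sum g j" if "i < j" "j \<le> p" for i j
  proof -
    have "partial_sum g i < partial_sum g (Suc i)"
      using assms[of i] that by (simp add: partial_sum_Suc)
    also have "\<dots> \<le> partial_sum g j"
      unfolding partial_sum_def using that by (intro sum_mono2) auto
    finally show ?thesis .
  qed
  then have "strict_mono_on {0..p} (partial_sum g)"
    by (intro strict_mono_onI) simp
  then show ?thesis
    unfolding incr_tuple_def by (simp add: partial_sum_def)
qed

lemma one_le_ln: "3 \<le> n \<Longrightarrow> 1 \<le> ln (real n)"
  using exp_le ln_ge_iff[of "real n" 1] by simp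

lemma card_less_real_le:
  fixes x :: real
  assumes "0 \<le> x"
  shows "real (card {d \<in> {1..n::nat}. real d < x}) \<le> x"
proof -
  have "card {d \<in> {1..n::nat}. real d < x} \<le> card {1..nat \<lfloor>x\<rfloor>}"
    by (rule card_mono) (auto simp: le_nat_floor)
  then have "card {d \<in> {1..n::nat}. real d < x} \<le> nat \<lfloor>x\<rfloor>" by simp
  then have "real (card {d \<in> {1..n::nat}. real d < x}) \<le> real (nat \<lfloor>x\<rfloor>)" by simp
  also have "\<dots> \<le> x" using assms by (rule of_nat_floor)
  finally show ?thesis .
qed

lemma eventually_ln_squared_le_linear:
  fixes e :: real
  assumes "0 < e"
  shows "\<forall>\<^sub>F n in sequentially. (ln (real n))\<^sup>2 \<le> e * real n"
  using assms by real_asymp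

section \<open>Almost independence as one product bound\<close>

locale almost_indep_events = prob_space M for M :: "'a measure" +
  fixes Om :: "nat \<Rightarrow> nat \<Rightarrow> 'a set"
    and \<rho> \<epsilon> :: "nat \<Rightarrow> real"
    and \<sigma> :: "real \<Rightarrow> real"
    and s sh :: "nat \<Rightarrow> nat"
    and r :: nat
  assumes r_pos: "1 \<le> r"
    and \<rho>_pos: "\<forall>n\<ge>1. 0 < \<rho> n"
    and \<rho>_antimono: "antimono_on {1..} \<rho>"
    and events: "is_event_family M Om"
    and fixed_scale: "almost_indep_fixed_scale M Om \<rho> r \<sigma> \<epsilon> s sh"
begin

definition v :: "nat \<Rightarrow> real" where "v n = \<sigma> (\<rho> n)"

text \<open>The factor that one gap contributes to the bound on a tuple. Of the power of the logarithm granted for a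
clustered tuple only \<open>ln n ^ 4\<close> per short gap is kept: summed over the at most
\<open>(ln n)\<^sup>2\<close> short gaps this leaves \<open>1 / (ln n)\<^sup>2\<close>, which is summable along dyadic scales.\<close>

definition weight :: "nat \<Rightarrow> nat \<Rightarrow> real" where
  "weight n d = (if s n \<le> d then v n else 1 / ln n ^ 4)"

lemma data: "independence_data r \<sigma> \<epsilon> s sh"
  using fixed_scale by (simp add: almost_indep_fixed_scale_def)

lemma M1_M2:
  assumes "1 \<le> p" "p \<le> 2 * r"
  shows "M1 M Om \<rho> \<sigma> \<epsilon> s p" "M2 M Om \<rho> \<sigma> s p"
  using fixed_scale assms by (auto simp: almost_indep_fixed_scale_def)

lemma v_nonneg: "1 \<le> n \<Longrightarrow> 0 \<le> v n"
  using data \<rho>_pos unfolding independence_data_def v_def by (meson less_imp_le)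

lemma \<rho>_le: "1 \<le> m \<Longrightarrow> m \<le> n \<Longrightarrow> \<rho> n \<le> \<rho> m"
  using \<rho>_antimono by (auto simp: monotone_on_def)

lemma v_antimono:
  assumes "1 \<le> m" "m \<le> n"
  shows "v n \<le> v m"
proof -
  have "0 \<le> \<rho> n" "0 \<le> \<rho> m"
    using \<rho>_pos assms by (auto intro: less_imp_le)
  then show ?thesis
    using data \<rho>_le[OF assms] unfolding independence_data_def v_def mono_on_def by auto
qed

lemma s_le: "1 \<le> n \<Longrightarrow> s n \<le> (ln n)\<^sup>2"
  using data unfolding independence_data_def by auto

lemma \<epsilon>_tendsto: "\<epsilon> \<longlonglongrightarrow> 0"
  using data unfolding independence_data_def by auto

lemma weight_nonneg: "1 \<le> n \<Longrightarrow> 0 \<le> weight n d"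
  unfolding weight_def using v_nonneg by simp

lemma event_sets: "1 \<le> k \<Longrightarrow> k \<le> n \<Longrightarrow> Om n k \<in> sets M"
  using events unfolding is_event_family_def by auto

text \<open>If \<open>m\<close> of the \<open>p\<close> gaps are long, the product of weights is \<open>v n ^ m * (1 / ln n ^ 4) ^ (p - m)\<close>. For
\<open>m = p\<close> this is the bound for separated tuples, and for \<open>m < p\<close> it is weaker than the bound for clustered
ones because \<open>4 * (p - m) \<le> 100 * p\<close>. There are finitely many \<open>p\<close>, so one constant serves all of them.\<close>

lemma prob_tuple_le:
  obtains C where "1 \<le> C"
    "\<forall>\<^sub>F n in sequentially. \<forall>p k. 1 \<le> p \<and> p \<le> 2 * r \<and> incr_tuple p k \<and> k p \<le> n \<longrightarrow>
       prob (\<Inter>j\<in>{1..p}. Om n (k j)) \<le> C * (\<Prod>j<p. weight n (k (Suc j) - k j))"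
proof -
  have "\<forall>p\<in>{1..2 * r}. \<exists>K>0. \<forall>n k m. 2 \<le> n \<and> incr_tuple p k \<and> k p \<le> n \<and> Sep s n p k = m \<and> m < p \<longrightarrow>
        prob (\<Inter>j\<in>{1..p}. Om n (k j)) \<le> K * v n ^ m / (ln (real n)) ^ (100 * p)"
  proof
    fix p assume "p \<in> {1..2 * r}"
    then have "M2 M Om \<rho> \<sigma> s p" using M1_M2(2) by simp
    then show "\<exists>K>0. \<forall>n k m. 2 \<le> n \<and> incr_tuple p k \<and> k p \<le> n \<and> Sep s n p k = m \<and> m < p \<longrightarrow>
        prob (\<Inter>j\<in>{1..p}. Om n (k j)) \<le> K * v n ^ m / (ln (real n)) ^ (100 * p)"
      unfolding M2_def v_def .
  qed
  then obtain K where K0: "\<And>p. p \<in> {1..2 * r} \<Longrightarrow> 0 < K p"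
    and K: "\<And>p n k. p \<in> {1..2 * r} \<Longrightarrow> 2 \<le> n \<Longrightarrow> incr_tuple p k \<Longrightarrow> k p \<le> n \<Longrightarrow> Sep s n p k < p \<Longrightarrow>
        prob (\<Inter>j\<in>{1..p}. Om n (k j)) \<le> K p * v n ^ Sep s n p k / (ln (real n)) ^ (100 * p)"
    by metis
  define C where "C = 2 + (\<Sum>p\<in>{1..2 * r}. K p)"
  have K_le: "K p \<le> C" if "p \<in> {1..2 * r}" for p
    using member_le_sum[OF that, of K] K0 unfolding C_def by (simp add: less_imp_le)
  have "0 \<le> (\<Sum>p\<in>{1..2 * r}. K p)"
    using K0 by (intro sum_nonneg less_imp_le)
  then have C2: "2 \<le> C"
    unfolding C_def by simp
  have "\<forall>\<^sub>F n in sequentially. \<epsilon> n < 1"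
    using \<epsilon>_tendsto by (rule order_tendstoD) simp
  then have "\<forall>\<^sub>F n in sequentially. \<forall>p k. 1 \<le> p \<and> p \<le> 2 * r \<and> incr_tuple p k \<and> k p \<le> n \<longrightarrow>
       prob (\<Inter>j\<in>{1..p}. Om n (k j)) \<le> C * (\<Prod>j<p. weight n (k (Suc j) - k j))"
    using eventually_ge_at_top[of 3]
  proof eventually_elim
    case (elim n)
    show ?case
    proof (intro allI impI; elim conjE)
      fix p k assume p: "1 \<le> p" "p \<le> 2 * r" and k: "incr_tuple p k" "k p \<le> n"
      define m where "m = Sep s n p k"
      define L where "L = ln (real n)"
      have L1: "1 \<le> L" unfolding L_def using elim by (intro one_le_ln) simp
      have v0: "0 \<le> v n" using elim by (intro v_nonneg) simp
      have prod_eq: "(\<Prod>j<p. weight n (k (Suc j) - k j)) = v n ^ m * (1 / L ^ 4) ^ (p - m)"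
      proof -
        define B where "B = {..<p} \<inter> {j. s n \<le> k (Suc j) - k j}"
        have "B = {j \<in> {0..<p}. s n \<le> k (Suc j) - k j}"
          unfolding B_def by auto
        then have cB: "card B = m"
          unfolding m_def Sep_def by simp
        have "{..<p} \<inter> - {j. s n \<le> k (Suc j) - k j} = {..<p} - B"
          unfolding B_def by auto
        moreover have "card ({..<p} - B) = p - m"
          using cB by (subst card_Diff_subset) (auto simp: B_def)
        ultimately show ?thesis
          unfolding weight_def by (subst prod.If_cases) (simp_all add: cB L_def flip: B_def)
      qed
      show "prob (\<Inter>j\<in>{1..p}. Om n (k j)) \<le> C * (\<Prod>j<p. weight n (k (Suc j) - k j))"
      proof (cases "m < p")
        case True
        have "prob (\<Inter>j\<in>{1..p}. Om n (k j)) \<le> K p * v n ^ m / L ^ (100 * p)"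
          unfolding m_def L_def using elim p k True[unfolded m_def] by (intro K) auto
        also have "\<dots> \<le> K p * v n ^ m / L ^ (4 * (p - m))"
          using L1 v0 K0[of p] p by (intro divide_left_mono power_increasing mult_pos_pos) auto
        also have "\<dots> = K p * (v n ^ m * (1 / L ^ 4) ^ (p - m))"
          by (simp add: power_mult power_divide)
        also have "\<dots> \<le> C * (v n ^ m * (1 / L ^ 4) ^ (p - m))"
          using K_le[of p] p v0 L1 by (intro mult_right_mono) auto
        finally show ?thesis unfolding prod_eq .
      next
        case False
        then have mp: "m = p" using Sep_le[of s n p k] unfolding m_def by simp
        have "prob (\<Inter>j\<in>{1..p}. Om n (k j)) \<le> v n ^ p * (1 + \<epsilon> n)"
          using M1_M2(1)[OF p] k mp unfolding M1_def m_def v_def by blast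
        also have "\<dots> \<le> v n ^ p * C"
          using elim C2 v0 by (intro mult_left_mono) auto
        finally show ?thesis unfolding prod_eq mp by (simp add: mult.commute)
      qed
    qed
  qed
  then show ?thesis using that[of C] C2 by simp
qed

text \<open>The product bound transported along the enumeration of a set: a gap of the tuple is long exactly
when its right endpoint is left isolated in the set.\<close>

lemma prob_set_le:
  obtains C where "1 \<le> C"
    "\<forall>\<^sub>F n in sequentially. \<forall>U. U \<noteq> {} \<and> U \<subseteq> {1..n} \<and> card U \<le> 2 * r \<longrightarrow>
       prob (\<Inter>x\<in>U. Om n x) \<le> C * (\<Prod>x\<in>U. if left_isolated (s n) U x then v n else 1 / ln n ^ 4)"
proof -
  obtain C where C: "1 \<le> C" and
    ev: "\<forall>\<^sub>F n in sequentially. \<forall>p k. 1 \<le> p \<and> p \<le> 2 * r \<and> incr_tuple p k \<and> k p \<le> n \<longrightarrow>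
       prob (\<Inter>j\<in>{1..p}. Om n (k j)) \<le> C * (\<Prod>j<p. weight n (k (Suc j) - k j))"
    by (rule prob_tuple_le)
  from ev have "\<forall>\<^sub>F n in sequentially. \<forall>U. U \<noteq> {} \<and> U \<subseteq> {1..n} \<and> card U \<le> 2 * r \<longrightarrow>
       prob (\<Inter>x\<in>U. Om n x) \<le> C * (\<Prod>x\<in>U. if left_isolated (s n) U x then v n else 1 / ln n ^ 4)"
  proof eventually_elim
    case (elim n)
    show ?case
    proof (intro allI impI; elim conjE)
      fix U assume U: "U \<noteq> {}" "U \<subseteq> {1..n}" "card U \<le> 2 * r"
      define p where "p = card U"
      define F where "F = (\<lambda>x. if left_isolated (s n) U x then v n else 1 / ln n ^ 4)"
      have finU: "finite U" using U(2) by (rule finite_subset) simp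
      have "0 \<notin> U" using U(2) by force
      then obtain k where k: "incr_tuple p k" "k ` {1..p} = U"
        using ex_incr_tuple_enumerating[OF finU] unfolding p_def by metis
      have p1: "1 \<le> p" unfolding p_def using U(1) finU by (simp add: Suc_le_eq card_gt_0_iff)
      have "p \<in> {1..p}" using p1 by simp
      then have "k p \<in> U" using k(2) by blast
      then have kp: "k p \<le> n" using U(2) by force
      have ks: "k ` (Suc ` {..<p}) = U"
        using k(2) by (simp add: image_Suc_lessThan)
      have "inj_on k (Suc ` {..<p})"
        using incr_tuple_inj[OF k(1)] by (rule inj_on_subset) (simp add: image_Suc_lessThan)
      then have inj: "inj_on (\<lambda>j. k (Suc j)) {..<p}"
        using comp_inj_on[of Suc "{..<p}" k] by (simp add: comp_def)
      have "(\<Prod>j<p. weight n (k (Suc j) - k j)) = (\<Prod>j<p. F (k (Suc j)))"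
      proof (rule prod.cong[OF refl])
        fix j assume "j \<in> {..<p}"
        then have "left_isolated (s n) U (k (Suc j)) \<longleftrightarrow> s n \<le> k (Suc j) - k j"
          using left_isolated_incr_tuple[OF k(1), of j "s n"] k(2) by simp
        then show "weight n (k (Suc j) - k j) = F (k (Suc j))"
          unfolding weight_def F_def by (simp only:)
      qed
      also have "\<dots> = (\<Prod>x\<in>(\<lambda>j. k (Suc j)) ` {..<p}. F x)"
        using inj by (simp add: prod.reindex)
      also have "(\<lambda>j. k (Suc j)) ` {..<p} = U"
        using ks by (simp add: image_image)
      finally have prod_eq: "(\<Prod>j<p. weight n (k (Suc j) - k j)) = (\<Prod>x\<in>U. F x)" .
      have "(\<Inter>j\<in>{1..p}. Om n (k j)) = (\<Inter>x\<in>U. Om n x)"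
        using k(2) by blast
      then show "prob (\<Inter>x\<in>U. Om n x) \<le> C * (\<Prod>x\<in>U. if left_isolated (s n) U x then v n else 1 / ln n ^ 4)"
        using elim[rule_format, of p k] p1 U(3) k(1) kp prod_eq
        unfolding p_def[symmetric] F_def[symmetric] by simp
    qed
  qed
  then show ?thesis using that C by blast
qed

section \<open>The convergent case\<close>

text \<open>Gaps of those \<open>r\<close>-tuples whose entries are at most \<open>2 ^ Suc j\<close>.\<close>

definition gap_vectors :: "nat \<Rightarrow> (nat \<Rightarrow> nat) set" where
  "gap_vectors j = {g \<in> {..<r} \<rightarrow>\<^sub>E {1..2 ^ Suc j}. partial_sum g r \<le> 2 ^ Suc j}"

text \<open>The smallest scale that is at least \<open>2 ^ j\<close> and at which all entries of the tuple are admissible times.\<close>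

definition hit_scale :: "nat \<Rightarrow> (nat \<Rightarrow> nat) \<Rightarrow> nat" where
  "hit_scale j g = max (partial_sum g r) (2 ^ j)"

definition block_event :: "nat \<Rightarrow> 'a set" where
  "block_event j = (\<Union>g\<in>gap_vectors j. \<Inter>i\<in>{1..r}. Om (hit_scale j g) (partial_sum g i))"

lemma finite_gap_vectors: "finite (gap_vectors j)"
  unfolding gap_vectors_def by (rule finite_subset[of _ "{..<r} \<rightarrow>\<^sub>E {1..2 ^ Suc j}"]) (auto intro!: finite_PiE)

lemma gap_vectors_incr:
  assumes "g \<in> gap_vectors j"
  shows "incr_tuple r (partial_sum g)"
  using assms unfolding gap_vectors_def by (intro incr_tuple_partial_sum) (auto simp: PiE_def Pi_def)

lemma tuple_event_sets:
  assumes "incr_tuple p k" "1 \<le> p" "k p \<le> n"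
  shows "(\<Inter>i\<in>{1..p}. Om n (k i)) \<in> sets M"
proof (rule sets.finite_INT)
  fix i assume i: "i \<in> {1..p}"
  have "k 0 < k i" "k i \<le> k p"
    using i incr_tuple_less[OF assms(1), of 0 i] incr_tuple_le[OF assms(1), of i p] by simp_all
  then show "Om n (k i) \<in> sets M"
    using assms(3) by (intro event_sets) simp_all
qed (use assms(2) in auto)

lemma hit_event_sets:
  assumes "g \<in> gap_vectors j"
  shows "(\<Inter>i\<in>{1..r}. Om (hit_scale j g) (partial_sum g i)) \<in> sets M"
  using gap_vectors_incr[OF assms] r_pos by (rule tuple_event_sets) (simp add: hit_scale_def)

lemma block_event_sets: "block_event j \<in> sets M"
  unfolding block_event_def using finite_gap_vectors hit_event_sets by (intro sets.finite_UN)

text \<open>The tuple of \<open>r\<close> occurring times has its last entry at most \<open>n\<close>, so its hitting scale is at most \<open>n\<close> and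
nestedness carries each of the \<open>r\<close> events there. The resulting event no longer depends on \<open>n\<close>.\<close>

lemma many_events_in_block:
  assumes nested: "nested_events \<rho> Om"
    and n: "2 ^ j \<le> n" "n < 2 ^ Suc j"
    and many: "r \<le> num_events Om n \<omega>"
  shows "\<omega> \<in> block_event j"
proof -
  obtain U where U: "U \<subseteq> {k \<in> {1..n}. \<omega> \<in> Om n k}" "card U = r"
    using many unfolding num_events_def by (rule obtain_subset_with_card_n)
  have finU: "finite U" by (rule finite_subset[OF U(1)]) simp
  have "0 \<notin> U" using U(1) by auto
  then obtain k where k: "incr_tuple r k" "k ` {1..r} = U"
    using ex_incr_tuple_enumerating[OF finU] U(2) by metis
  define g where "g = restrict (\<lambda>t. k (Suc t) - k t) {..<r}"
  have gaps: "k t < k (Suc t)" if "t < r" for t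
    using incr_tuple_less[OF k(1), of t "Suc t"] that by simp
  have mem: "1 \<le> k i \<and> k i \<le> n \<and> \<omega> \<in> Om n (k i)" if "i \<in> {1..r}" for i
  proof -
    have "k i \<in> U" using that k(2) by blast
    then show ?thesis using U(1) by auto
  qed
  have pos: "i \<le> r \<Longrightarrow> partial_sum g i = k i" for i
  proof (induction i)
    case 0
    then show ?case using k(1) by (simp add: incr_tuple_def partial_sum_def)
  next
    case (Suc i)
    then show ?case using gaps[of i] by (simp add: partial_sum_Suc g_def)
  qed
  have kr: "k r \<le> n" using mem[of r] r_pos by simp
  have "g \<in> {..<r} \<rightarrow>\<^sub>E {1..2 ^ Suc j}"
  proof (rule PiE_I)
    fix t assume "t \<in> {..<r}"
    then have t: "t < r" by simp
    then have "k t < k (Suc t)" "k (Suc t) < 2 ^ Suc j"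
      using gaps[of t] mem[of "Suc t"] n(2) by simp_all
    then show "g t \<in> {1..2 ^ Suc j}"
      using t unfolding g_def atLeastAtMost_iff restrict_def lessThan_iff by (simp only: if_True) linarith
  qed (simp add: g_def)
  then have g: "g \<in> gap_vectors j"
    unfolding gap_vectors_def using pos[of r] kr n(2) by simp
  have "\<omega> \<in> Om (hit_scale j g) (partial_sum g i)" if i: "i \<in> {1..r}" for i
  proof -
    define m where "m = hit_scale j g"
    have m: "m = max (k r) (2 ^ j)" unfolding m_def hit_scale_def using pos[of r] by simp
    have "k i \<le> k r" using incr_tuple_le[OF k(1), of i r] i by simp
    then have "k i \<le> m" "m \<le> n" "1 \<le> m"
      using m kr n by simp_all
    then have "Om n (k i) \<subseteq> Om m (k i)"
      using nested mem[OF i] \<rho>_le[of m n] unfolding nested_events_def by blast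
    then show ?thesis
      using mem[OF i] pos[of i] i unfolding m_def by auto
  qed
  then show ?thesis
    unfolding block_event_def using g by blast
qed

text \<open>The union bound over gap vectors. Although the scale varies with the tuple, it stays in
\<open>[2 ^ j, 2 ^ Suc j]\<close>, where the logarithm varies at most by a factor 2; hence one function \<open>f\<close> of a
single gap dominates the weights at all these scales. The sum then factorises into the \<open>r\<close>-th power of
\<open>\<Sum>d. f d\<close>, to which arbitrary gaps contribute \<open>2 ^ Suc j * v (2 ^ j)\<close> and short ones
\<open>4 / (ln (2 ^ j))\<^sup>2\<close>.\<close>

lemma prob_block_event_le:
  obtains C where
    "\<forall>\<^sub>F j in sequentially. prob (block_event j) \<le> C * (2 ^ Suc j * v (2 ^ j) + 4 / (ln (2 ^ j))\<^sup>2) ^ r"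
proof -
  obtain C where C: "1 \<le> C"
    and "\<forall>\<^sub>F n in sequentially. \<forall>p k. 1 \<le> p \<and> p \<le> 2 * r \<and> incr_tuple p k \<and> k p \<le> n \<longrightarrow>
       prob (\<Inter>j\<in>{1..p}. Om n (k j)) \<le> C * (\<Prod>j<p. weight n (k (Suc j) - k j))"
    by (rule prob_tuple_le)
  then obtain n0 where bound: "\<And>n p k. n0 \<le> n \<Longrightarrow> 1 \<le> p \<Longrightarrow> p \<le> 2 * r \<Longrightarrow> incr_tuple p k \<Longrightarrow> k p \<le> n \<Longrightarrow>
       prob (\<Inter>j\<in>{1..p}. Om n (k j)) \<le> C * (\<Prod>j<p. weight n (k (Suc j) - k j))"
    unfolding eventually_sequentially by blast
  have "\<forall>\<^sub>F j in sequentially. prob (block_event j) \<le> C * (2 ^ Suc j * v (2 ^ j) + 4 / (ln (2 ^ j))\<^sup>2) ^ r"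
    using eventually_ge_at_top[of n0] eventually_ge_at_top[of 2]
  proof eventually_elim
    case (elim j)
    define N :: nat where "N = 2 ^ Suc j"
    define L where "L = ln (real (2 ^ j))"
    define V where "V = v (2 ^ j)"
    \<comment> \<open>\<open>4 * L\<^sup>2\<close> bounds \<open>s m\<close> for every \<open>m\<close> between \<open>2 ^ j\<close> and \<open>N\<close>, as \<open>ln m \<le> 2 * L\<close> there.\<close>
    define f where "f = (\<lambda>d::nat. V + (if real d < 4 * L\<^sup>2 then 1 / L ^ 4 else 0))"
    have j4: "4 \<le> (2::nat) ^ j"
      using power_increasing[of 2 j "2::nat"] elim(2) by simp
    have L1: "1 \<le> L" unfolding L_def using j4 by (intro one_le_ln) simp
    have V0: "0 \<le> V" unfolding V_def using j4 by (intro v_nonneg) simp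
    have "j < 2 ^ j" by (rule less_exp)
    then have n0: "n0 \<le> 2 ^ j" using elim(1) by linarith
    have weight_le: "weight m d \<le> f d" if m: "2 ^ j \<le> m" "m \<le> N" for m d
    proof -
      have m1: "1 \<le> m" using m(1) j4 by simp
      have lnm: "L \<le> ln m" "ln m \<le> 2 * L"
      proof -
        show "L \<le> ln m" unfolding L_def using m(1) m1 j4 by (subst ln_le_cancel_iff) simp_all
        have "ln m \<le> ln N" using m m1 by simp
        also have "\<dots> = ln (2 * 2 ^ j)" unfolding N_def by simp
        also have "\<dots> = ln 2 + L" unfolding L_def by (subst ln_mult) simp_all
        also have "ln 2 \<le> L" using L1 ln_2_less_1 by simp
        finally show "ln m \<le> 2 * L" by simp
      qed
      have "(ln m)\<^sup>2 \<le> (2 * L)\<^sup>2" using lnm L1 by (intro power_mono) simp_all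
      then have sm: "real (s m) \<le> 4 * L\<^sup>2" using s_le[OF m1] by (simp add: power_mult_distrib)
      show ?thesis
      proof (cases "s m \<le> d")
        case True
        have "v m \<le> V" unfolding V_def using m(1) j4 by (intro v_antimono) simp_all
        moreover have "0 \<le> 1 / L ^ 4" using L1 by simp
        ultimately show ?thesis unfolding weight_def f_def using True by (simp only: if_True split: if_split) linarith
      next
        case False
        then have "real d < 4 * L\<^sup>2" using sm by simp
        moreover have "1 / ln m ^ 4 \<le> 1 / L ^ 4"
          using lnm L1 by (intro divide_left_mono power_mono mult_pos_pos) simp_all
        ultimately show ?thesis unfolding weight_def f_def using False V0 by simp
      qed
    qed
    have f0: "0 \<le> f d" for d unfolding f_def using V0 by simp
    have "prob (block_event j) \<le> (\<Sum>g\<in>gap_vectors j. prob (\<Inter>i\<in>{1..r}. Om (hit_scale j g) (partial_sum g i)))"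
      unfolding block_event_def using finite_gap_vectors hit_event_sets by (rule measure_UNION_le)
    also have "\<dots> \<le> (\<Sum>g\<in>gap_vectors j. C * (\<Prod>t<r. f (g t)))"
    proof (rule sum_mono)
      fix g assume g: "g \<in> gap_vectors j"
      define m where "m = hit_scale j g"
      have m: "2 ^ j \<le> m" "m \<le> N" "partial_sum g r \<le> m"
        using g unfolding m_def hit_scale_def N_def gap_vectors_def by simp_all
      have "prob (\<Inter>i\<in>{1..r}. Om m (partial_sum g i))
          \<le> C * (\<Prod>t<r. weight m (partial_sum g (Suc t) - partial_sum g t))"
        using m n0 r_pos gap_vectors_incr[OF g] by (intro bound) simp_all
      also have "\<dots> \<le> C * (\<Prod>t<r. f (g t))"
        using C m j4 by (intro mult_left_mono prod_mono)
          (simp_all add: partial_sum_Suc weight_le weight_nonneg)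
      finally show "prob (\<Inter>i\<in>{1..r}. Om (hit_scale j g) (partial_sum g i)) \<le> C * (\<Prod>t<r. f (g t))"
        unfolding m_def .
    qed
    also have "\<dots> \<le> (\<Sum>g\<in>{..<r} \<rightarrow>\<^sub>E {1..N}. C * (\<Prod>t<r. f (g t)))"
      using C f0 by (intro sum_mono2) (auto simp: gap_vectors_def N_def intro!: finite_PiE mult_nonneg_nonneg prod_nonneg)
    also have "\<dots> = C * (\<Prod>t<r. \<Sum>d\<in>{1..N}. f d)"
      by (subst prod_sum_PiE) (simp_all add: sum_distrib_left)
    also have "\<dots> = C * (\<Sum>d\<in>{1..N}. f d) ^ r"
      by simp
    also have "\<dots> \<le> C * (2 ^ Suc j * V + 4 / L\<^sup>2) ^ r"
    proof -
      have "(\<Sum>d\<in>{1..N}. f d) = N * V + (\<Sum>d\<in>{1..N}. if real d < 4 * L\<^sup>2 then 1 / L ^ 4 else 0)"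
        unfolding f_def by (simp add: sum.distrib)
      also have "(\<Sum>d\<in>{1..N}. if real d < 4 * L\<^sup>2 then 1 / L ^ 4 else 0)
          = card {d \<in> {1..N}. real d < 4 * L\<^sup>2} * (1 / L ^ 4)"
        by (subst sum.inter_filter[symmetric]) simp_all
      also have "\<dots> \<le> 4 * L\<^sup>2 * (1 / L ^ 4)"
        using L1 by (intro mult_right_mono card_less_real_le) simp_all
      also have "\<dots> = 4 / L\<^sup>2"
        using L1 by (simp add: power2_eq_square power4_eq_xxxx)
      finally have "(\<Sum>d\<in>{1..N}. f d) \<le> 2 ^ Suc j * V + 4 / L\<^sup>2"
        unfolding N_def by simp
      then show ?thesis
        using C f0 by (intro mult_left_mono power_mono sum_nonneg) simp_all
    qed
    finally show ?case unfolding V_def L_def by simp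
  qed
  then show ?thesis by (rule that)
qed

text \<open>\<open>(a + b) ^ r \<le> 2 ^ r * (a ^ r + b ^ r)\<close> separates the series of the hypothesis from a multiple of
\<open>\<Sum>j. 1 / j\<^sup>2\<close>.\<close>

lemma summable_block_bound:
  assumes "summable (\<lambda>j. (2 ^ j * v (2 ^ j)) ^ r)"
  shows "summable (\<lambda>j. (2 ^ Suc j * v (2 ^ j) + 4 / (ln (2 ^ j))\<^sup>2) ^ r)"
proof (rule summable_comparison_test_ev)
  define D :: real where "D = 4 / (ln 2)\<^sup>2"
  show "summable (\<lambda>j. 2 ^ r * (2 ^ r * (2 ^ j * v (2 ^ j)) ^ r + D ^ r * inverse (real j ^ 2)))"
    using assms inverse_power_summable[of 2, where ?'a = real]
    by (intro summable_mult summable_add) simp_all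
  show "\<forall>\<^sub>F j in sequentially. norm ((2 ^ Suc j * v (2 ^ j) + 4 / (ln (2 ^ j))\<^sup>2) ^ r)
      \<le> 2 ^ r * (2 ^ r * (2 ^ j * v (2 ^ j)) ^ r + D ^ r * inverse (real j ^ 2))"
    using eventually_ge_at_top[of 1]
  proof eventually_elim
    case (elim j)
    define a where "a = 2 ^ Suc j * v (2 ^ j)"
    define b where "b = 4 / (ln (2 ^ j :: real))\<^sup>2"
    have a0: "0 \<le> a" unfolding a_def using v_nonneg[of "2 ^ j"] by simp
    have b0: "0 \<le> b" unfolding b_def by simp
    have b_eq: "b = D * inverse (real j ^ 2)"
      unfolding b_def D_def by (simp add: ln_realpow power_mult_distrib field_simps)
    have "inverse (real j ^ 2) ^ r \<le> inverse (real j ^ 2) ^ 1"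
      using r_pos elim by (intro power_decreasing) (simp_all add: inverse_le_1_iff)
    then have br: "b ^ r \<le> D ^ r * inverse (real j ^ 2)"
      unfolding b_eq power_mult_distrib D_def by (intro mult_left_mono) simp_all
    have ar: "a ^ r = 2 ^ r * (2 ^ j * v (2 ^ j)) ^ r"
      unfolding a_def by (simp add: power_mult_distrib mult.assoc)
    have "(a + b) ^ r \<le> (2 * max a b) ^ r"
      using a0 b0 by (intro power_mono) simp_all
    also have "\<dots> = 2 ^ r * (max a b) ^ r"
      by (simp add: power_mult_distrib)
    also have "(max a b) ^ r \<le> a ^ r + b ^ r"
      using a0 b0 by (simp add: max_def)
    also have "\<dots> \<le> 2 ^ r * (2 ^ j * v (2 ^ j)) ^ r + D ^ r * inverse (real j ^ 2)"
      using ar br by simp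
    finally show ?case
      using a0 b0 unfolding a_def b_def by simp
  qed
qed

lemma eventually_few_events:
  assumes nested: "nested_events \<rho> Om" and finite_sum: "S_sum r \<sigma> \<rho> < \<infinity>"
  shows "AE \<omega> in M. \<forall>\<^sub>F n in sequentially. num_events Om n \<omega> < r"
proof -
  have "summable (\<lambda>j. (2 ^ Suc j * v (2 ^ Suc j)) ^ r)"
  proof (rule summable_suminf_not_top)
    show "0 \<le> (2 ^ Suc j * v (2 ^ Suc j)) ^ r" for j
      using v_nonneg[of "2 ^ Suc j"] by simp
    show "(\<Sum>j. ennreal ((2 ^ Suc j * v (2 ^ Suc j)) ^ r)) \<noteq> \<top>"
      using finite_sum unfolding S_sum_def v_def infinity_ennreal_def by (rule less_imp_neq)
  qed
  then have "summable (\<lambda>j. (2 ^ j * v (2 ^ j)) ^ r)"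
    by (rule iffD1[OF summable_Suc_iff])
  then have bound: "summable (\<lambda>j. (2 ^ Suc j * v (2 ^ j) + 4 / (ln (2 ^ j))\<^sup>2) ^ r)"
    by (rule summable_block_bound)
  obtain C where C: "\<forall>\<^sub>F j in sequentially.
      prob (block_event j) \<le> C * (2 ^ Suc j * v (2 ^ j) + 4 / (ln (2 ^ j))\<^sup>2) ^ r"
    by (rule prob_block_event_le)
  have "summable (\<lambda>j. prob (block_event j))"
  proof (rule summable_comparison_test_ev)
    show "\<forall>\<^sub>F j in sequentially. norm (prob (block_event j))
        \<le> C * (2 ^ Suc j * v (2 ^ j) + 4 / (ln (2 ^ j))\<^sup>2) ^ r"
      using C by simp
  qed (rule summable_mult[OF bound])
  then have "AE \<omega> in M. \<forall>\<^sub>F j in sequentially. \<omega> \<in> space M - block_event j"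
    by (intro borel_cantelli_AE1 block_event_sets) (simp_all add: emeasure_eq_measure)
  then show ?thesis
  proof eventually_elim
    case (elim \<omega>)
    then obtain J where J: "\<And>j. J \<le> j \<Longrightarrow> \<omega> \<notin> block_event j"
      unfolding eventually_sequentially by blast
    show ?case
      unfolding eventually_sequentially
    proof (intro exI allI impI)
      fix n :: nat assume n: "2 ^ J \<le> n"
      have "(1::nat) \<le> 2 ^ J" by simp
      then have "1 \<le> n" using n by (rule order_trans)
      then obtain j where j: "2 ^ j \<le> n" "n < 2 ^ Suc j"
        using ex_power_ivl1[of 2 n] by auto
      have "(2::nat) ^ J < 2 ^ Suc j" using n j(2) by (rule le_less_trans)
      then have "J < Suc j" by (rule power_less_imp_less_exp[rotated]) simp
      then have "\<omega> \<notin> block_event j" by (intro J) simp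
      then have "\<not> r \<le> num_events Om n \<omega>"
        using many_events_in_block[OF nested j] by blast
      then show "num_events Om n \<omega> < r" by simp
    qed
  qed
qed

section \<open>Windows inside a dyadic block\<close>

definition scale :: "nat \<Rightarrow> nat" where "scale i = 2 ^ Suc i"

text \<open>The \<open>t\<close>-th window of width \<open>w\<close> in the dyadic block \<open>(2 ^ i, 2 ^ Suc i]\<close>. Spaces of length
\<open>sh (scale i)\<close> lie between consecutive windows and also before the first one; the latter keeps the
entries far from everything in earlier blocks.\<close>

definition window :: "nat \<Rightarrow> nat \<Rightarrow> nat \<Rightarrow> nat set" where
  "window w i t = {2 ^ i + Suc t * sh (scale i) + t * w <.. 2 ^ i + Suc t * sh (scale i) + Suc t * w}"

definition box :: "nat \<Rightarrow> nat \<Rightarrow> (nat \<Rightarrow> nat) set" where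
  "box w i = (\<Pi>\<^sub>E t\<in>{..<r}. window w i t)"

text \<open>The windows fit into the block, and spaces between them are not short gaps.\<close>

definition roomy :: "nat \<Rightarrow> nat \<Rightarrow> bool" where
  "roomy w i \<longleftrightarrow> s (scale i) \<le> sh (scale i) \<and> sh (scale i) \<le> 2 ^ i
     \<and> r * sh (scale i) + r * w \<le> 2 ^ i"

definition hit :: "nat \<Rightarrow> (nat \<Rightarrow> nat) \<Rightarrow> 'a set" where
  "hit i k = (\<Inter>t\<in>{..<r}. Om (scale i) (k t))"

lemma scale_ge_1: "1 \<le> scale i"
  unfolding scale_def by simp

lemma card_window: "card (window w i t) = w"
  unfolding window_def by simp

lemma finite_window: "finite (window w i t)"
  unfolding window_def by simp

lemma card_box: "card (box w i) = w ^ r"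
  unfolding box_def by (simp add: card_PiE card_window)

lemma box_mem: "k \<in> box w i \<Longrightarrow> t < r \<Longrightarrow> k t \<in> window w i t"
  unfolding box_def by (auto simp: PiE_def Pi_def)

lemma windows_spaced:
  assumes "x \<in> window w i t" "y \<in> window w i t'" "t < t'"
  shows "x + sh (scale i) < y"
proof -
  define h where "h = sh (scale i)"
  have "x + h \<le> 2 ^ i + Suc (Suc t) * h + Suc t * w"
    using assms(1) unfolding window_def h_def by simp
  also have "\<dots> \<le> 2 ^ i + Suc t' * h + t' * w"
    using assms(3) by (intro add_mono mult_right_mono) simp_all
  also have "\<dots> < y"
    using assms(2) unfolding window_def h_def by simp
  finally show ?thesis unfolding h_def .
qed

lemma window_bounds:
  assumes "roomy w i" "x \<in> window w i t" "t < r"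
  shows "2 ^ i + sh (scale i) < x" "x \<le> scale i"
proof -
  define h where "h = sh (scale i)"
  have "h \<le> Suc t * h + t * w" by simp
  then show "2 ^ i + sh (scale i) < x"
    using assms(2) unfolding window_def h_def[symmetric] greaterThanAtMost_iff by linarith
  have "x \<le> 2 ^ i + (Suc t * h + Suc t * w)"
    using assms(2) unfolding window_def h_def by simp
  also have "\<dots> \<le> 2 ^ i + (r * h + r * w)"
    using assms(3) by (intro add_mono mult_right_mono) simp_all
  also have "\<dots> \<le> 2 ^ i + 2 ^ i"
    using assms(1) unfolding roomy_def h_def by (intro add_mono) simp_all
  also have "\<dots> = scale i" unfolding scale_def by simp
  finally show "x \<le> scale i" .
qed

lemma hit_sets:
  assumes "roomy w i" "k \<in> box w i"
  shows "hit i k \<in> sets M"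
  unfolding hit_def
proof (rule sets.finite_INT)
  show "{..<r} \<noteq> {}" using r_pos by (simp add: lessThan_empty_iff)
  fix t assume "t \<in> {..<r}"
  then have "k t \<in> window w i t" "t < r" using box_mem[OF assms(2)] by simp_all
  then show "Om (scale i) (k t) \<in> sets M"
    using window_bounds[OF assms(1), of "k t" t] by (intro event_sets) simp_all
qed simp

text \<open>A choice of one time per window is a tuple that is separated in both senses, so that
the two-sided bound at one scale and the bound for two scales both apply to it.\<close>

lemma box_tuple:
  assumes "roomy w i" "k \<in> box w i"
  defines "k' \<equiv> case_nat 0 k"
  shows "incr_tuple r k'" "Sep sh (scale i) r k' = r" "Sep s (scale i) r k' = r"
    "k' r \<le> scale i" "(\<Inter>j\<in>{1..r}. Om n (k' j)) = (\<Inter>t\<in>{..<r}. Om n (k t))"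
    "\<And>j. j \<in> {1..r} \<Longrightarrow> 2 ^ i + sh (scale i) < k' j \<and> k' j \<le> scale i"
proof -
  have k'_Suc: "k' (Suc t) = k t" and k'_0: "k' 0 = 0" for t
    unfolding k'_def by simp_all
  have room: "s (scale i) \<le> sh (scale i)" "sh (scale i) \<le> 2 ^ i"
    using assms(1) unfolding roomy_def by simp_all
  show bounds: "2 ^ i + sh (scale i) < k' j \<and> k' j \<le> scale i" if j: "j \<in> {1..r}" for j
  proof -
    obtain t where t: "j = Suc t" "t < r" using j by (cases j) simp_all
    then show ?thesis
      using window_bounds[OF assms(1) box_mem[OF assms(2) t(2)] t(2)] k'_Suc by simp
  qed
  have gap: "k' a + sh (scale i) < k' c" if "a < c" "c \<le> r" for a c
  proof (cases a)
    case 0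
    then show ?thesis using bounds[of c] that k'_0 by simp
  next
    case (Suc t)
    have "0 < c" using that(1) by simp
    then obtain u where u: "c = Suc u" using gr0_implies_Suc by blast
    have "t < u" "u < r" using that Suc u by simp_all
    then show ?thesis
      using windows_spaced[OF box_mem[OF assms(2), of t] box_mem[OF assms(2), of u]] k'_Suc Suc u by simp
  qed
  have less: "k' a < k' c" if "a < c" "c \<le> r" for a c
    using gap[OF that] by simp
  have "strict_mono_on {0..r} k'"
    by (rule strict_mono_onI) (simp add: less)
  then show "incr_tuple r k'"
    unfolding incr_tuple_def using k'_0 by simp
  have big: "sh (scale i) \<le> k' (Suc j) - k' j" if "j < r" for j
    using gap[of j "Suc j"] that by linarith
  then show "Sep sh (scale i) r k' = r"
    unfolding Sep_eq_iff by blast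
  show "Sep s (scale i) r k' = r"
    unfolding Sep_eq_iff using big room(1) order_trans by blast
  show "k' r \<le> scale i"
    using bounds[of r] r_pos by simp
  have "{1..r} = Suc ` {..<r}" by (simp add: image_Suc_lessThan)
  then show "(\<Inter>j\<in>{1..r}. Om n (k' j)) = (\<Inter>t\<in>{..<r}. Om n (k t))"
    by (simp add: k'_Suc image_image)
qed

lemma prob_hit_ge:
  assumes "roomy w i" "k \<in> box w i"
  shows "v (scale i) ^ r * (1 - \<epsilon> (scale i)) \<le> prob (hit i k)"
proof -
  have "M1 M Om \<rho> \<sigma> \<epsilon> s r" using r_pos by (intro M1_M2) simp_all
  then have "v (scale i) ^ r * (1 - \<epsilon> (scale i)) \<le> prob (\<Inter>j\<in>{1..r}. Om (scale i) (case_nat 0 k j))"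
    using box_tuple[OF assms] unfolding M1_def v_def by blast
  then show ?thesis
    unfolding box_tuple(5)[OF assms] hit_def .
qed

text \<open>The later tuple starts more than \<open>sh (scale j)\<close> after \<open>2 ^ j\<close>, which the earlier tuple does not
exceed, so the two tuples are as far apart as required even when the blocks are adjacent.\<close>

lemma prob_hit_two_scales:
  assumes "M3 M Om \<rho> \<sigma> \<epsilon> sh r"
  obtains b where "\<And>w w' i j k l. roomy w i \<Longrightarrow> roomy w' j \<Longrightarrow> k \<in> box w i \<Longrightarrow> l \<in> box w' j \<Longrightarrow> i + b \<le> j \<Longrightarrow>
    prob (hit i k \<inter> hit j l) \<le> v (scale i) ^ r * v (scale j) ^ r * (1 + \<epsilon> i)"
proof -
  obtain b where b: "1 \<le> b" and M3: "\<And>i j k l.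
        incr_tuple r k \<Longrightarrow> incr_tuple r l \<Longrightarrow> k r < l 1 \<Longrightarrow>
        (\<forall>\<alpha>\<in>{1..r}. 2 ^ i < k \<alpha> \<and> k \<alpha> \<le> 2 ^ (i + 1)) \<Longrightarrow>
        (\<forall>\<beta>\<in>{1..r}. 2 ^ j < l \<beta> \<and> l \<beta> \<le> 2 ^ (j + 1)) \<Longrightarrow>
        i + b \<le> j \<Longrightarrow>
        Sep sh (2 ^ (i + 1)) r k = r \<Longrightarrow> Sep sh (2 ^ (j + 1)) r l = r \<Longrightarrow>
        sh (2 ^ (j + 1)) \<le> l 1 - k r \<Longrightarrow>
        prob ((\<Inter>\<alpha>\<in>{1..r}. Om (2 ^ (i + 1)) (k \<alpha>)) \<inter> (\<Inter>\<beta>\<in>{1..r}. Om (2 ^ (j + 1)) (l \<beta>)))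
          \<le> \<sigma> (\<rho> (2 ^ (i + 1))) ^ r * \<sigma> (\<rho> (2 ^ (j + 1))) ^ r * (1 + \<epsilon> i)"
    using assms unfolding M3_def by blast
  show ?thesis
  proof (rule that)
    fix w w' i j k l
    assume kl: "roomy w i" "roomy w' j" "k \<in> box w i" "l \<in> box w' j" "i + b \<le> j"
    note k' = box_tuple[OF kl(1,3)] and l' = box_tuple[OF kl(2,4)]
    define k' where "k' = case_nat 0 k"
    define l' where "l' = case_nat 0 l"
    have sc: "2 ^ (i + 1) = scale i" for i unfolding scale_def by simp
    have "Suc i \<le> j" using b kl(5) by simp
    then have "scale i \<le> 2 ^ j" unfolding scale_def by (intro power_increasing) simp_all
    moreover have "k' r \<le> scale i" unfolding k'_def by (rule k'(4))
    moreover have "2 ^ j + sh (scale j) < l' 1" unfolding l'_def using l'(6)[of 1] r_pos by simp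
    ultimately have sep: "k' r < l' 1" "sh (scale j) \<le> l' 1 - k' r" by linarith+
    have "prob ((\<Inter>\<alpha>\<in>{1..r}. Om (2 ^ (i + 1)) (k' \<alpha>)) \<inter> (\<Inter>\<beta>\<in>{1..r}. Om (2 ^ (j + 1)) (l' \<beta>)))
          \<le> \<sigma> (\<rho> (2 ^ (i + 1))) ^ r * \<sigma> (\<rho> (2 ^ (j + 1))) ^ r * (1 + \<epsilon> i)"
    proof (rule M3)
      show "incr_tuple r k'" "incr_tuple r l'" unfolding k'_def l'_def by (fact k'(1) l'(1))+
      show "k' r < l' 1" "sh (2 ^ (j + 1)) \<le> l' 1 - k' r" unfolding sc by (fact sep)+
      show "i + b \<le> j" by fact
      show "Sep sh (2 ^ (i + 1)) r k' = r" unfolding sc k'_def by (fact k'(2))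
      show "Sep sh (2 ^ (j + 1)) r l' = r" unfolding sc l'_def by (fact l'(2))
      show "\<forall>\<alpha>\<in>{1..r}. 2 ^ i < k' \<alpha> \<and> k' \<alpha> \<le> 2 ^ (i + 1)"
        unfolding sc k'_def using k'(6) add_lessD1 by blast
      show "\<forall>\<beta>\<in>{1..r}. 2 ^ j < l' \<beta> \<and> l' \<beta> \<le> 2 ^ (j + 1)"
        unfolding sc l'_def using l'(6) add_lessD1 by blast
    qed
    then show "prob (hit i k \<inter> hit j l) \<le> v (scale i) ^ r * v (scale j) ^ r * (1 + \<epsilon> i)"
      unfolding sc k'_def l'_def k'(5) l'(5) hit_def v_def .
  qed
qed

text \<open>Dominates the contribution of two times \<open>a\<close>, \<open>b\<close> in one window to the product bound for a union of two
tuples. The smaller time is always isolated and gives \<open>v n\<close>; the larger one is absent if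
\<open>a = b\<close>, and otherwise gives \<open>v n\<close> or \<open>1 / ln n ^ 4\<close> according to its distance from the smaller.\<close>

definition pair_weight :: "nat \<Rightarrow> nat \<Rightarrow> nat \<Rightarrow> real" where
  "pair_weight n a b = v n * ((if a = b then 1 else 0) + v n
     + (if a < b + s n \<and> b < a + s n then 1 / ln n ^ 4 else 0))"

lemma pair_weight_nonneg: "1 \<le> n \<Longrightarrow> 0 \<le> pair_weight n a b"
  unfolding pair_weight_def using v_nonneg[of n] by simp

text \<open>Of the 3, one comes from \<open>b = a\<close> and two from the at most \<open>2 * s n \<le> 2 * (ln n)\<^sup>2\<close> times \<open>b\<close> near \<open>a\<close>.\<close>

lemma sum_pair_weight_le:
  assumes "3 \<le> n" "finite W"
  shows "(\<Sum>b\<in>W. pair_weight n a b) \<le> v n * (3 + card W * v n)"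
proof -
  define L where "L = ln (real n)"
  have L1: "1 \<le> L" unfolding L_def using assms(1) by (rule one_le_ln)
  have v0: "0 \<le> v n" using assms(1) by (intro v_nonneg) simp
  have "(\<Sum>b\<in>W. if a = b then 1 else 0 :: real) \<le> 1"
    using assms(2) by simp
  moreover have "(\<Sum>b\<in>W. if a < b + s n \<and> b < a + s n then 1 / L ^ 4 else 0) \<le> 2"
  proof -
    have "{b \<in> W. a < b + s n \<and> b < a + s n} \<subseteq> {a - s n..<a + s n}"
      by auto
    then have "card {b \<in> W. a < b + s n \<and> b < a + s n} \<le> card {a - s n..<a + s n}"
      by (intro card_mono) simp_all
    also have "\<dots> \<le> 2 * s n" by simp
    finally have "real (card {b \<in> W. a < b + s n \<and> b < a + s n}) \<le> 2 * L\<^sup>2"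
      using s_le[of n] assms(1) unfolding L_def by simp
    then have "card {b \<in> W. a < b + s n \<and> b < a + s n} * (1 / L ^ 4) \<le> 2 * L\<^sup>2 * (1 / L ^ 4)"
      using L1 by (intro mult_right_mono) simp_all
    also have "\<dots> = 2 / L\<^sup>2"
      using L1 by (simp add: power2_eq_square power4_eq_xxxx)
    also have "\<dots> \<le> 2"
      using L1 by (simp add: divide_le_eq)
    also have "real (card {b \<in> W. a < b + s n \<and> b < a + s n}) * (1 / L ^ 4)
        = (\<Sum>b\<in>W. if a < b + s n \<and> b < a + s n then 1 / L ^ 4 else 0)"
      using assms(2) by (subst sum.inter_filter[symmetric]) simp_all
    finally show ?thesis .
  qed
  ultimately have "(\<Sum>b\<in>W. (if a = b then 1 else 0) + v n
      + (if a < b + s n \<and> b < a + s n then 1 / L ^ 4 else 0)) \<le> 3 + card W * v n"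
    by (simp add: sum.distrib)
  then show ?thesis
    unfolding pair_weight_def L_def sum_distrib_left[symmetric] using v0 by (intro mult_left_mono)
qed

text \<open>Distinct windows are so far apart that whether a time is left isolated in the union is decided inside
its own window. The product over the union therefore splits into products over the pairs.\<close>

lemma prod_pair_le:
  assumes "roomy w i" "k \<in> box w i" "l \<in> box w i" and n: "n = scale i" "3 \<le> n"
    and U: "U = (\<Union>t\<in>{..<r}. {k t, l t})"
  shows "(\<Prod>x\<in>U. if left_isolated (s n) U x then v n else 1 / ln n ^ 4)
     \<le> (\<Prod>t<r. pair_weight n (k t) (l t))"
proof -
  define F where "F = (\<lambda>x. if left_isolated (s n) U x then v n else 1 / ln n ^ 4)"
  have v0: "0 \<le> v n" using n(2) by (intro v_nonneg) simp
  have ln1: "1 \<le> ln (real n)" using n(2) by (rule one_le_ln)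
  have F0: "0 \<le> F x" for x unfolding F_def using v0 ln1 by simp
  have room: "s n \<le> sh n" "sh n \<le> 2 ^ i"
    using assms(1) unfolding roomy_def n(1) by simp_all
  have win: "x \<in> window w i t" if "x \<in> {k t, l t}" "t < r" for x t
    using that box_mem[OF assms(2)] box_mem[OF assms(3)] by blast
  have spaced: "x + s n \<le> y" if "x \<in> {k t, l t}" "y \<in> {k t', l t'}" "t < t'" "t' < r" for x y t t'
  proof -
    have "x + sh n < y"
      using windows_spaced[OF win win] that unfolding n(1) by simp
    then show ?thesis using room by simp
  qed
  have iso: "left_isolated (s n) U x \<longleftrightarrow> (\<forall>y\<in>{k t, l t}. y < x \<longrightarrow> s n \<le> x - y)"
    if x: "x \<in> {k t, l t}" and t: "t < r" for x t
  proof
    assume "left_isolated (s n) U x"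
    moreover have "{k t, l t} \<subseteq> U" using t unfolding U by blast
    ultimately show "\<forall>y\<in>{k t, l t}. y < x \<longrightarrow> s n \<le> x - y"
      unfolding left_isolated_def by blast
  next
    assume own: "\<forall>y\<in>{k t, l t}. y < x \<longrightarrow> s n \<le> x - y"
    show "left_isolated (s n) U x"
      unfolding left_isolated_def
    proof (intro ballI impI)
      fix y assume "y \<in> insert 0 U" and less: "y < x"
      then consider "y = 0" | t' where "t' < r" "y \<in> {k t', l t'}"
        unfolding U by blast
      then show "s n \<le> x - y"
      proof cases
        case 1
        then show ?thesis
          using window_bounds(1)[OF assms(1) win[OF x t] t] room unfolding n(1) by linarith
      next
        case 2
        consider "t' = t" | "t' < t" | "t < t'" by linarith
        then show ?thesis
        proof cases
          case 1
          then show ?thesis using own 2 less by blast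
        next
          case t'_less: 2
          then show ?thesis using spaced[OF 2(2) x t'_less t] by linarith
        next
          case t_less: 3
          then show ?thesis using spaced[OF x 2(2) t_less 2(1)] less by linarith
        qed
      qed
    qed
  qed
  have ordered: "(\<Prod>x\<in>{a, c}. F x) \<le> v n * (v n + (if a < c + s n \<and> c < a + s n then 1 / ln n ^ 4 else 0))"
    if ac: "{a, c} = {k t, l t}" "a < c" and t: "t < r" for a c t
  proof -
    have "left_isolated (s n) U a"
      using iso[of a t] t ac unfolding ac(1)[symmetric] by simp
    then have Fa: "F a = v n" unfolding F_def by simp
    have "left_isolated (s n) U c \<longleftrightarrow> s n \<le> c - a"
      using iso[of c t] t ac(2) unfolding ac(1)[symmetric] by simp
    then have Fc: "F c = (if s n \<le> c - a then v n else 1 / ln n ^ 4)"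
      unfolding F_def by (simp only:)
    have "F c \<le> v n + (if a < c + s n \<and> c < a + s n then 1 / ln n ^ 4 else 0)"
    proof (cases "s n \<le> c - a")
      case True
      then show ?thesis using Fc ln1 by simp
    next
      case False
      then have "a < c + s n \<and> c < a + s n" using ac(2) by linarith
      then show ?thesis using Fc False v0 by (simp only: if_False if_True simp_thms)
    qed
    then show ?thesis using ac(2) Fa v0 by (simp add: mult_left_mono)
  qed
  have pair: "(\<Prod>x\<in>{k t, l t}. F x) \<le> pair_weight n (k t) (l t)" if t: "t < r" for t
  proof -
    consider "k t = l t" | "k t < l t" | "l t < k t" by linarith
    then show ?thesis
    proof cases
      case 1
      have "left_isolated (s n) U (k t)" using iso[of "k t" t] t 1 by simp
      then have "F (k t) = v n * 1" unfolding F_def by simp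
      also have "\<dots> \<le> pair_weight n (k t) (l t)"
        unfolding pair_weight_def using 1 v0 ln1 by (intro mult_left_mono) simp_all
      finally show ?thesis using 1 by simp
    next
      case 2
      then show ?thesis using ordered[OF refl 2 t] unfolding pair_weight_def by simp
    next
      case 3
      have "{l t, k t} = {k t, l t}" by blast
      from ordered[OF this 3 t] show ?thesis
        using 3 unfolding pair_weight_def by (simp add: insert_commute conj_commute)
    qed
  qed
  have "(\<Prod>x\<in>U. F x) = (\<Prod>t<r. \<Prod>x\<in>{k t, l t}. F x)"
    unfolding U
  proof (rule prod.UNION_disjoint)
    show "\<forall>t\<in>{..<r}. \<forall>t'\<in>{..<r}. t \<noteq> t' \<longrightarrow> {k t, l t} \<inter> {k t', l t'} = {}"
    proof (intro ballI impI)
      fix t t' assume t: "t \<in> {..<r}" "t' \<in> {..<r}" "t \<noteq> t'"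
      have "x \<noteq> y" if "x \<in> {k t, l t}" "y \<in> {k t', l t'}" for x y
      proof (cases "t < t'")
        case True
        then show ?thesis using windows_spaced[OF win win True] that t by force
      next
        case False
        then have "t' < t" using t by simp
        then show ?thesis using windows_spaced[OF win win \<open>t' < t\<close>] that t by force
      qed
      then show "{k t, l t} \<inter> {k t', l t'} = {}" by blast
    qed
  qed simp_all
  also have "\<dots> \<le> (\<Prod>t<r. pair_weight n (k t) (l t))"
    using pair F0 by (intro prod_mono conjI prod_nonneg) simp_all
  finally show ?thesis unfolding F_def .
qed

text \<open>After the product bound, the double sum over pairs of tuples factorises over the windows, and each window
contributes \<open>w * (v * (3 + w * v))\<close>.\<close>

lemma second_moment_hits:
  obtains C where "1 \<le> C"
    "\<forall>\<^sub>F i in sequentially. \<forall>w. roomy w i \<longrightarrow>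
       (\<Sum>k\<in>box w i. \<Sum>l\<in>box w i. prob (hit i k \<inter> hit i l))
         \<le> C * (w * v (scale i) * (3 + w * v (scale i))) ^ r"
proof -
  obtain C where C: "1 \<le> C" and
    "\<forall>\<^sub>F n in sequentially. \<forall>U. U \<noteq> {} \<and> U \<subseteq> {1..n} \<and> card U \<le> 2 * r \<longrightarrow>
       prob (\<Inter>x\<in>U. Om n x) \<le> C * (\<Prod>x\<in>U. if left_isolated (s n) U x then v n else 1 / ln n ^ 4)"
    by (rule prob_set_le)
  then obtain n0 where bound: "\<forall>n\<ge>n0. \<forall>U. U \<noteq> {} \<and> U \<subseteq> {1..n} \<and> card U \<le> 2 * r \<longrightarrow>
       prob (\<Inter>x\<in>U. Om n x) \<le> C * (\<Prod>x\<in>U. if left_isolated (s n) U x then v n else 1 / ln n ^ 4)"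
    unfolding eventually_sequentially by (elim exE)
  have "\<forall>\<^sub>F i in sequentially. \<forall>w. roomy w i \<longrightarrow>
       (\<Sum>k\<in>box w i. \<Sum>l\<in>box w i. prob (hit i k \<inter> hit i l))
         \<le> C * (w * v (scale i) * (3 + w * v (scale i))) ^ r"
    using eventually_ge_at_top[of n0] eventually_ge_at_top[of 1]
  proof eventually_elim
    case (elim i)
    show ?case
    proof (intro allI impI)
      fix w assume room: "roomy w i"
      define n where "n = scale i"
      have "i < 2 ^ i" by (rule less_exp)
      moreover have "(2::nat) ^ i \<le> n" unfolding n_def scale_def by simp
      ultimately have n: "n0 \<le> n" using elim(1) by linarith
      have "(2::nat) ^ 2 \<le> 2 ^ Suc i" using elim(2) by (intro power_increasing) simp_all
      then have n3: "3 \<le> n" unfolding n_def scale_def by simp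
      have v0: "0 \<le> v n" using n3 by (intro v_nonneg) simp
      have pair: "prob (hit i k \<inter> hit i l) \<le> C * (\<Prod>t<r. pair_weight n (k t) (l t))"
        if kl: "k \<in> box w i" "l \<in> box w i" for k l
      proof -
        define U where "U = (\<Union>t\<in>{..<r}. {k t, l t})"
        have "card U \<le> (\<Sum>t<r. card {k t, l t})"
          unfolding U_def by (rule card_UN_le) simp
        also have "\<dots> \<le> (\<Sum>t<r. 2)"
          by (intro sum_mono) (simp add: card_insert_if)
        finally have cardU: "card U \<le> 2 * r" by simp
        have "0 < r" using r_pos by simp
        then have U_ne: "U \<noteq> {}" unfolding U_def by blast
        have U_sub: "U \<subseteq> {1..n}"
        proof
          fix x assume "x \<in> U"
          then obtain t where t: "t < r" "x \<in> {k t, l t}" unfolding U_def by blast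
          then have "x \<in> window w i t" using box_mem[OF kl(1)] box_mem[OF kl(2)] by blast
          then show "x \<in> {1..n}" using window_bounds[OF room _ t(1)] unfolding n_def by force
        qed
        have "hit i k \<inter> hit i l = (\<Inter>x\<in>U. Om n x)"
          unfolding hit_def U_def n_def by blast
        then have "prob (hit i k \<inter> hit i l)
            \<le> C * (\<Prod>x\<in>U. if left_isolated (s n) U x then v n else 1 / ln n ^ 4)"
          using bound[rule_format, OF n, of U] U_ne U_sub cardU by (simp only: simp_thms)
        also have "\<dots> \<le> C * (\<Prod>t<r. pair_weight n (k t) (l t))"
          using C prod_pair_le[OF room kl n_def n3 U_def] by (intro mult_left_mono) simp_all
        finally show ?thesis .
      qed
      have "(\<Sum>k\<in>box w i. \<Sum>l\<in>box w i. prob (hit i k \<inter> hit i l))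
          \<le> (\<Sum>k\<in>box w i. \<Sum>l\<in>box w i. C * (\<Prod>t<r. pair_weight n (k t) (l t)))"
        by (intro sum_mono pair)
      also have "\<dots> = (\<Sum>k\<in>box w i. C * (\<Prod>t<r. \<Sum>b\<in>window w i t. pair_weight n (k t) b))"
      proof (rule sum.cong[OF refl])
        fix k
        have "(\<Prod>t<r. \<Sum>b\<in>window w i t. pair_weight n (k t) b)
            = (\<Sum>l\<in>box w i. \<Prod>t<r. pair_weight n (k t) (l t))"
          unfolding box_def by (rule prod_sum_PiE) (simp_all add: finite_window)
        then show "(\<Sum>l\<in>box w i. C * (\<Prod>t<r. pair_weight n (k t) (l t)))
            = C * (\<Prod>t<r. \<Sum>b\<in>window w i t. pair_weight n (k t) b)"
          by (simp only: sum_distrib_left)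
      qed
      also have "\<dots> \<le> (\<Sum>k\<in>box w i. C * (\<Prod>t<r. v n * (3 + w * v n)))"
        using C n3 sum_pair_weight_le[OF n3 finite_window[of w i]]
        by (intro sum_mono mult_left_mono prod_mono conjI sum_nonneg pair_weight_nonneg)
          (simp_all add: card_window)
      also have "\<dots> = C * (w * v n * (3 + w * v n)) ^ r"
        by (simp add: card_box power_mult_distrib)
      finally show "(\<Sum>k\<in>box w i. \<Sum>l\<in>box w i. prob (hit i k \<inter> hit i l))
         \<le> C * (w * v (scale i) * (3 + w * v (scale i))) ^ r" unfolding n_def .
    qed
  qed
  then show ?thesis using that C by blast
qed

section \<open>The divergent case\<close>

lemma filterlim_scale: "filterlim scale at_top sequentially"
  by (rule filterlim_subseq) (simp add: strict_mono_def scale_def)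

text \<open>The first term lets the windows fill at most the part of the block left over by the spaces between them.
The second prevents the expected number of events per window from exceeding a constant; without it the second
moment would not be of the order of the mean.\<close>

definition width :: "real \<Rightarrow> nat \<Rightarrow> nat" where
  "width q i = min (nat \<lfloor>q * scale i / (2 * r)\<rfloor>) (nat \<lceil>1 / v (scale i)\<rceil>)"

definition expected_hits :: "real \<Rightarrow> nat \<Rightarrow> real" where
  "expected_hits q i = width q i * v (scale i)"

lemma expected_hits_nonneg: "0 \<le> expected_hits q i"
  unfolding expected_hits_def using v_nonneg[OF scale_ge_1] by simp

lemma expected_hits_le: "expected_hits q i \<le> 1 + v 1"
proof -
  have v0: "0 \<le> v (scale i)" using v_nonneg[OF scale_ge_1] .
  have v1: "v (scale i) \<le> v 1" using scale_ge_1 by (intro v_antimono) simp_all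
  show ?thesis
  proof (cases "v (scale i) = 0")
    case True
    then show ?thesis unfolding expected_hits_def using v1 by simp
  next
    case False
    then have v: "0 < v (scale i)" using v0 by simp
    have "real (width q i) \<le> real (nat \<lceil>1 / v (scale i)\<rceil>)"
      unfolding width_def by simp
    also have "\<dots> \<le> 1 / v (scale i) + 1"
      using v by (simp add: of_nat_nat ceiling_correct less_imp_le)
    finally have "expected_hits q i \<le> (1 / v (scale i) + 1) * v (scale i)"
      unfolding expected_hits_def using v0 by (rule mult_right_mono)
    also have "\<dots> = 1 + v (scale i)" using v by (simp add: field_simps)
    finally show ?thesis using v1 by simp
  qed
qed

text \<open>The \<open>r\<close> spaces take less than \<open>(1 - q) / 2\<close> of \<open>scale i\<close>, the \<open>r\<close> windows at most \<open>q / 2\<close>, and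
the block has length \<open>scale i / 2\<close>. The spaces are not short because they grow linearly.\<close>

lemma eventually_roomy:
  obtains q where "0 < q" "\<forall>\<^sub>F i in sequentially. roomy (width q i) i"
proof -
  obtain q e where q: "0 < q" "q < 1" and e: "0 < e"
    and ev: "\<forall>\<^sub>F n in sequentially.
           e * real n \<le> real (sh n) \<and> real (sh n) < real n * (1 - q) / (2 * real r)"
    using data unfolding independence_data_def by blast
  have "\<forall>\<^sub>F n in sequentially. s n \<le> sh n \<and> real (sh n) < real n * (1 - q) / (2 * real r)"
    using ev eventually_ln_squared_le_linear[OF e] eventually_ge_at_top[of 1]
  proof eventually_elim
    case (elim n)
    then have "real (s n) \<le> real (sh n)" using s_le[of n] by linarith
    then show ?case using elim by simp
  qed
  then have "\<forall>\<^sub>F i in sequentially. s (scale i) \<le> sh (scale i)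
      \<and> real (sh (scale i)) < real (scale i) * (1 - q) / (2 * real r)"
    by (rule eventually_compose_filterlim[OF _ filterlim_scale])
  then have "\<forall>\<^sub>F i in sequentially. roomy (width q i) i"
  proof eventually_elim
    case (elim i)
    define h where "h = sh (scale i)"
    have r0: "0 < real r" using r_pos by simp
    have sc: "real (scale i) = 2 * 2 ^ i" unfolding scale_def by simp
    have "real h < (2 * 2 ^ i) * (1 - q) / (2 * real r)"
      using elim unfolding h_def sc by simp
    then have rh: "r * real h \<le> 2 ^ i * (1 - q)"
      using r0 by (simp add: field_simps)
    have "real (width q i) \<le> real (nat \<lfloor>q * scale i / (2 * r)\<rfloor>)"
      unfolding width_def by simp
    also have "\<dots> \<le> q * scale i / (2 * r)"
      using q r0 by (intro of_nat_floor) simp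
    finally have "r * real (width q i) \<le> 2 ^ i * q"
      using r0 unfolding sc by (simp add: field_simps)
    then have "r * real h + r * real (width q i) \<le> 2 ^ i"
      using rh by (simp add: algebra_simps)
    then have "real (r * h + r * width q i) \<le> real (2 ^ i)" by simp
    then have total: "r * h + r * width q i \<le> 2 ^ i" by (simp only: of_nat_le_iff)
    have "h \<le> r * h" using r_pos by simp
    then have "h \<le> 2 ^ i" using total by linarith
    then show ?case using elim total unfolding roomy_def h_def by blast
  qed
  then show ?thesis using that q(1) by blast
qed

lemma expected_hits_lower:
  assumes "0 < q"
  shows "\<forall>\<^sub>F i in sequentially. min 1 (q / (4 * r) * (scale i * v (scale i))) \<le> expected_hits q i"
proof -
  define c where "c = q / (2 * r)"
  have c: "0 < c" unfolding c_def using assms r_pos by simp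
  have "\<forall>\<^sub>F n in sequentially. 2 / c \<le> real n"
    by real_asymp
  then have "\<forall>\<^sub>F i in sequentially. 2 / c \<le> real (scale i)"
    by (rule eventually_compose_filterlim[OF _ filterlim_scale])
  then show ?thesis
  proof eventually_elim
    case (elim i)
    have v0: "0 \<le> v (scale i)" using v_nonneg[OF scale_ge_1] .
    show ?case
    proof (cases "v (scale i) = 0")
      case True
      then show ?thesis unfolding expected_hits_def by simp
    next
      case False
      then have v: "0 < v (scale i)" using v0 by simp
      show ?thesis
      proof (cases "nat \<lceil>1 / v (scale i)\<rceil> \<le> nat \<lfloor>q * scale i / (2 * r)\<rfloor>")
        case True
        then have "1 / v (scale i) \<le> real (width q i)"
          unfolding width_def by (simp only: min_absorb2 real_nat_ceiling_ge)
        then have "1 \<le> expected_hits q i"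
          unfolding expected_hits_def using v by (simp add: field_simps)
        then show ?thesis by simp
      next
        case False
        then have "width q i = nat \<lfloor>q * scale i / (2 * r)\<rfloor>"
          unfolding width_def by (intro min_absorb1) linarith
        moreover have "q * scale i / (2 * r) = c * scale i"
          unfolding c_def by simp
        ultimately have w: "width q i = nat \<lfloor>c * scale i\<rfloor>"
          by (simp only:)
        have "2 \<le> c * scale i" using elim c by (simp add: field_simps)
        then have "c * scale i / 2 \<le> c * scale i - 1" by simp
        also have "\<dots> \<le> real (width q i)"
          unfolding w by linarith
        finally have "c * scale i / 2 * v (scale i) \<le> expected_hits q i"
          unfolding expected_hits_def using v0 by (rule mult_right_mono)
        then show ?thesis unfolding c_def by (simp add: mult.assoc min.coboundedI2)
      qed
    qed
  qed
qed

text \<open>If the series converged, its terms would eventually be below 1, hence they would not come from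
the cut-off \<open>1 / v\<close>, and would dominate a multiple of the terms of the divergent series.\<close>

lemma expected_hits_not_summable:
  assumes "0 < q" "S_sum r \<sigma> \<rho> = \<infinity>"
  shows "\<not> summable (\<lambda>i. expected_hits q i ^ r)"
proof
  assume sum: "summable (\<lambda>i. expected_hits q i ^ r)"
  define c where "c = q / (4 * r)"
  have c: "0 < c" unfolding c_def using assms r_pos by simp
  define x where "x = (\<lambda>i. scale i * v (scale i))"
  have x0: "0 \<le> x i" for i unfolding x_def using v_nonneg[OF scale_ge_1] by simp
  have "(\<lambda>i. expected_hits q i ^ r) \<longlonglongrightarrow> 0" using sum by (rule summable_LIMSEQ_zero)
  then have "\<forall>\<^sub>F i in sequentially. expected_hits q i ^ r < 1" by (rule order_tendstoD) simp
  then have "\<forall>\<^sub>F i in sequentially. norm (x i ^ r) \<le> (1 / c) ^ r * expected_hits q i ^ r"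
    using expected_hits_lower[OF assms(1)]
  proof eventually_elim
    case (elim i)
    have "expected_hits q i < 1"
      using elim(1) one_le_power[of "expected_hits q i" r] by (meson not_less)
    then have "c * x i \<le> expected_hits q i"
      using elim(2) unfolding c_def x_def by (simp add: min_le_iff_disj)
    then have "x i \<le> 1 / c * expected_hits q i" using c by (simp add: field_simps)
    then have "x i ^ r \<le> (1 / c * expected_hits q i) ^ r" using x0 by (rule power_mono)
    then show ?case using x0[of i] by (simp add: power_mult_distrib power_divide)
  qed
  moreover have "summable (\<lambda>i. (1 / c) ^ r * expected_hits q i ^ r)"
    using sum by (rule summable_mult)
  ultimately have "summable (\<lambda>i. x i ^ r)"
    by (rule summable_comparison_test_ev)
  then have "(\<Sum>i. ennreal (x i ^ r)) \<noteq> \<top>"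
    using x0 by (intro ennreal_suminf_neq_top) simp_all
  moreover have "S_sum r \<sigma> \<rho> = (\<Sum>i. ennreal (x i ^ r))"
    unfolding S_sum_def x_def v_def scale_def by simp
  ultimately show False using assms(2) by (simp add: infinity_ennreal_def)
qed

text \<open>Empty for a block without room for the windows, whose entries need not be admissible times; so the counts
below are random variables for every \<open>i\<close>.\<close>

definition hit_vectors :: "real \<Rightarrow> nat \<Rightarrow> (nat \<Rightarrow> nat) set" where
  "hit_vectors q i = (if roomy (width q i) i then box (width q i) i else {})"

definition hit_count :: "real \<Rightarrow> nat \<Rightarrow> 'a \<Rightarrow> real" where
  "hit_count q i \<omega> = (\<Sum>k\<in>hit_vectors q i. indicator (hit i k) \<omega>)"

lemma hit_vectors_sets: "k \<in> hit_vectors q i \<Longrightarrow> hit i k \<in> sets M"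
  unfolding hit_vectors_def by (simp add: hit_sets split: if_splits)

lemma integrable_hit_count: "integrable M (hit_count q i)"
  unfolding hit_count_def by (intro integrable_count hit_vectors_sets)

lemma expectation_hit_count: "expectation (hit_count q i) = (\<Sum>k\<in>hit_vectors q i. prob (hit i k))"
  unfolding hit_count_def by (intro expectation_count hit_vectors_sets)

lemma hit_count_mult:
  "hit_count q i \<omega> * hit_count q j \<omega>
    = (\<Sum>x\<in>hit_vectors q i \<times> hit_vectors q j. indicator (hit i (fst x) \<inter> hit j (snd x)) \<omega>)"
  unfolding hit_count_def count_mult_count by (simp add: case_prod_unfold)

lemma hit_inter_sets:
  "x \<in> hit_vectors q i \<times> hit_vectors q j \<Longrightarrow> hit i (fst x) \<inter> hit j (snd x) \<in> sets M"
  by (intro sets.Int hit_vectors_sets) auto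

lemma integrable_hit_count_mult: "integrable M (\<lambda>\<omega>. hit_count q i \<omega> * hit_count q j \<omega>)"
  unfolding hit_count_mult by (intro integrable_count hit_inter_sets)

lemma expectation_hit_count_mult:
  "expectation (\<lambda>\<omega>. hit_count q i \<omega> * hit_count q j \<omega>)
    = (\<Sum>k\<in>hit_vectors q i. \<Sum>l\<in>hit_vectors q j. prob (hit i k \<inter> hit j l))"
  unfolding hit_count_mult sum.cartesian_product case_prod_unfold
  by (intro expectation_count hit_inter_sets)

lemma hit_count_nonneg: "0 \<le> hit_count q i \<omega>"
  unfolding hit_count_def by (intro sum_nonneg) simp

lemma hit_count_pos_imp_many:
  assumes "0 < hit_count q i \<omega>"
  shows "r \<le> num_events Om (scale i) \<omega>"
proof -
  have "\<exists>k\<in>hit_vectors q i. indicator (hit i k) \<omega> \<noteq> (0::real)"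
  proof (rule ccontr)
    assume "\<not> ?thesis"
    then have "hit_count q i \<omega> = 0" unfolding hit_count_def by (intro sum.neutral) blast
    then show False using assms by simp
  qed
  then obtain k where k: "k \<in> hit_vectors q i" "\<omega> \<in> hit i k"
    by (auto simp: indicator_def split: if_splits)
  then have room: "roomy (width q i) i" and box: "k \<in> box (width q i) i"
    unfolding hit_vectors_def by (simp_all split: if_splits)
  have less: "k t < k t'" if "t < t'" "t' < r" for t t'
    using windows_spaced[OF box_mem[OF box, of t] box_mem[OF box, of t']] that by simp
  have "inj_on k {..<r}"
    by (rule linorder_inj_onI) (metis less less_irrefl lessThan_iff, linarith)
  then have "r = card (k ` {..<r})"
    by (simp add: card_image)
  also have "\<dots> \<le> card {x \<in> {1..scale i}. \<omega> \<in> Om (scale i) x}"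
  proof (rule card_mono)
    show "k ` {..<r} \<subseteq> {x \<in> {1..scale i}. \<omega> \<in> Om (scale i) x}"
    proof (rule image_subsetI)
      fix t assume "t \<in> {..<r}"
      then have t: "t < r" by simp
      then have "\<omega> \<in> Om (scale i) (k t)" using k(2) unfolding hit_def by blast
      moreover have "k t \<in> {1..scale i}"
        using window_bounds[OF room box_mem[OF box t] t] by simp
      ultimately show "k t \<in> {x \<in> {1..scale i}. \<omega> \<in> Om (scale i) x}" by blast
    qed
  qed simp
  finally show ?thesis unfolding num_events_def .
qed

text \<open>Each of the \<open>width q i ^ r\<close> tuples satisfies the lower bound for separated tuples.\<close>

lemma expectation_hit_count_ge:
  assumes room: "roomy (width q i) i" and eps: "\<bar>\<epsilon> (scale i)\<bar> \<le> \<eta>"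
  shows "expected_hits q i ^ r * (1 - \<eta>) \<le> expectation (hit_count q i)"
proof -
  define w where "w = width q i"
  have v0: "0 \<le> v (scale i)" using v_nonneg[OF scale_ge_1] .
  have "expected_hits q i ^ r * (1 - \<eta>) = (\<Sum>k\<in>box w i. v (scale i) ^ r * (1 - \<eta>))"
    unfolding expected_hits_def w_def by (simp add: card_box power_mult_distrib)
  also have "\<dots> \<le> (\<Sum>k\<in>box w i. prob (hit i k))"
  proof (rule sum_mono)
    fix k assume k: "k \<in> box w i"
    have "v (scale i) ^ r * (1 - \<eta>) \<le> v (scale i) ^ r * (1 - \<epsilon> (scale i))"
      using eps v0 by (intro mult_left_mono) simp_all
    also have "\<dots> \<le> prob (hit i k)"
      using room k unfolding w_def by (rule prob_hit_ge)
    finally show "v (scale i) ^ r * (1 - \<eta>) \<le> prob (hit i k)" .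
  qed
  also have "\<dots> = expectation (hit_count q i)"
    unfolding expectation_hit_count hit_vectors_def w_def using room by simp
  finally show ?thesis .
qed

text \<open>What the second-moment criterion needs is the bound on the diagonal, the bound at two scales
and the divergence of the means; the mean is at least half of \<open>u i ^ r\<close> for large \<open>i\<close>.\<close>

lemma infinitely_often_many_events:
  assumes M3: "M3 M Om \<rho> \<sigma> \<epsilon> sh r" and infinite_sum: "S_sum r \<sigma> \<rho> = \<infinity>"
  shows "AE \<omega> in M. \<exists>\<^sub>\<infinity>n. r \<le> num_events Om n \<omega>"
proof -
  obtain q where q: "0 < q" and room: "\<forall>\<^sub>F i in sequentially. roomy (width q i) i"
    by (rule eventually_roomy)
  define u where "u = expected_hits q"
  have u0: "0 \<le> u i" for i unfolding u_def by (rule expected_hits_nonneg)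
  have eps: "\<forall>\<^sub>F i in sequentially. \<bar>\<epsilon> i\<bar> \<le> \<eta>" if "0 < \<eta>" for \<eta>
  proof -
    have "\<forall>\<^sub>F i in sequentially. dist (\<epsilon> i) 0 < \<eta>"
      using \<epsilon>_tendsto that by (rule tendstoD)
    then show ?thesis by (rule eventually_mono) simp
  qed
  have eps_scale: "\<forall>\<^sub>F i in sequentially. \<bar>\<epsilon> (scale i)\<bar> \<le> \<eta>" if "0 < \<eta>" for \<eta>
    using eps[OF that] by (rule eventually_compose_filterlim[OF _ filterlim_scale])
  have half: "\<forall>\<^sub>F i in sequentially. u i ^ r \<le> 2 * expectation (hit_count q i)"
  proof -
    have "\<forall>\<^sub>F i in sequentially. \<bar>\<epsilon> (scale i)\<bar> \<le> 1 / 2"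
      by (rule eps_scale) simp
    with room show ?thesis
    proof eventually_elim
      case (elim i)
      then show ?case using expectation_hit_count_ge[of q i "1 / 2"] unfolding u_def by simp
    qed
  qed
  obtain C where C: "1 \<le> C" and second: "\<forall>\<^sub>F i in sequentially. \<forall>w. roomy w i \<longrightarrow>
       (\<Sum>k\<in>box w i. \<Sum>l\<in>box w i. prob (hit i k \<inter> hit i l))
         \<le> C * (w * v (scale i) * (3 + w * v (scale i))) ^ r"
    by (rule second_moment_hits)
  obtain b where two: "\<And>w w' i j k l. roomy w i \<Longrightarrow> roomy w' j \<Longrightarrow> k \<in> box w i \<Longrightarrow> l \<in> box w' j \<Longrightarrow> i + b \<le> j \<Longrightarrow>
    prob (hit i k \<inter> hit j l) \<le> v (scale i) ^ r * v (scale j) ^ r * (1 + \<epsilon> i)"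
    using prob_hit_two_scales[OF M3] by blast
  define D where "D = C * (4 + v 1) ^ r"
  have v1: "0 \<le> v 1" by (rule v_nonneg) simp
  have D0: "0 \<le> D" unfolding D_def using C v1 by simp
  have "AE \<omega> in M. \<exists>\<^sub>\<infinity>i. 0 < hit_count q i \<omega>"
  proof (rule second_moment_Borel_Cantelli)
    show "integrable M (hit_count q i)" for i by (rule integrable_hit_count)
    show "integrable M (\<lambda>\<omega>. hit_count q i \<omega> * hit_count q j \<omega>)" for i j
      by (rule integrable_hit_count_mult)
    show "0 \<le> hit_count q i \<omega>" for i \<omega> by (rule hit_count_nonneg)
    show "\<forall>\<^sub>F i in sequentially. expectation (\<lambda>\<omega>. hit_count q i \<omega> * hit_count q i \<omega>)
        \<le> 2 * D * expectation (hit_count q i)"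
      using room second half
    proof eventually_elim
      case (elim i)
      have "expectation (\<lambda>\<omega>. hit_count q i \<omega> * hit_count q i \<omega>) \<le> C * (u i * (3 + u i)) ^ r"
        using elim(1,2) unfolding expectation_hit_count_mult hit_vectors_def u_def expected_hits_def by simp
      also have "\<dots> \<le> C * (u i * (4 + v 1)) ^ r"
        using C u0[of i] expected_hits_le[of q i] unfolding u_def
        by (intro mult_left_mono power_mono mult_nonneg_nonneg) simp_all
      also have "\<dots> = D * u i ^ r" unfolding D_def by (simp add: power_mult_distrib)
      also have "\<dots> \<le> D * (2 * expectation (hit_count q i))"
        using elim(3) D0 by (rule mult_left_mono)
      finally show ?case by simp
    qed
    show "\<forall>\<^sub>F i in sequentially. \<forall>j\<ge>i + b. expectation (\<lambda>\<omega>. hit_count q i \<omega> * hit_count q j \<omega>)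
        \<le> (1 + \<delta>) * (expectation (hit_count q i) * expectation (hit_count q j))" if \<delta>: "0 < \<delta>" for \<delta>
    proof -
      \<comment> \<open>This value solves \<open>1 + \<eta> = (1 + \<delta>) * (1 - 2 * \<eta>)\<close>, so errors of size \<open>\<eta>\<close> in the joint
        probability and in both means cost at most the factor \<open>1 + \<delta>\<close>.\<close>
      define \<eta> where "\<eta> = \<delta> / (3 + 2 * \<delta>)"
      have \<eta>0: "0 < \<eta>" unfolding \<eta>_def using \<delta> by simp
      have \<eta>1: "\<eta> \<le> 1" unfolding \<eta>_def using \<delta> by (simp add: field_simps)
      have "\<eta> * (3 + 2 * \<delta>) = \<delta>" unfolding \<eta>_def using \<delta> by simp
      then have "1 + \<eta> = (1 + \<delta>) * (1 - 2 * \<eta>)" by (simp add: algebra_simps)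
      also have "\<dots> \<le> (1 + \<delta>) * ((1 - \<eta>) * (1 - \<eta>))"
        using \<delta> by (intro mult_left_mono) (simp_all add: algebra_simps)
      finally have \<eta>: "1 + \<eta> \<le> (1 + \<delta>) * ((1 - \<eta>) * (1 - \<eta>))" .
      have "\<forall>\<^sub>F i in sequentially. \<forall>j\<ge>i. roomy (width q j) j \<and> \<bar>\<epsilon> (scale j)\<bar> \<le> \<eta>"
        using eventually_conj[OF room eps_scale[OF \<eta>0]] by (rule eventually_all_ge_at_top)
      then show ?thesis
        using eps[OF \<eta>0]
      proof eventually_elim
        case (elim i)
        show ?case
        proof (intro allI impI)
          fix j assume j: "i + b \<le> j"
          have ri: "roomy (width q i) i" and ei: "\<bar>\<epsilon> (scale i)\<bar> \<le> \<eta>"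
            and rj: "roomy (width q j) j" and ej: "\<bar>\<epsilon> (scale j)\<bar> \<le> \<eta>"
            using elim(1) j by simp_all
          have "expectation (\<lambda>\<omega>. hit_count q i \<omega> * hit_count q j \<omega>)
              = (\<Sum>k\<in>box (width q i) i. \<Sum>l\<in>box (width q j) j. prob (hit i k \<inter> hit j l))"
            unfolding expectation_hit_count_mult hit_vectors_def using ri rj by simp
          also have "\<dots> \<le> (\<Sum>k\<in>box (width q i) i. \<Sum>l\<in>box (width q j) j.
              v (scale i) ^ r * v (scale j) ^ r * (1 + \<epsilon> i))"
            using two[OF ri rj _ _ j] by (intro sum_mono)
          also have "\<dots> = (u i ^ r * u j ^ r) * (1 + \<epsilon> i)"
            unfolding u_def expected_hits_def by (simp add: card_box power_mult_distrib)
          also have "\<dots> \<le> (u i ^ r * u j ^ r) * ((1 + \<delta>) * ((1 - \<eta>) * (1 - \<eta>)))"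
            using \<eta> elim(2) u0 by (intro mult_left_mono) (simp_all add: mult_nonneg_nonneg)
          also have "\<dots> = (1 + \<delta>) * ((u i ^ r * (1 - \<eta>)) * (u j ^ r * (1 - \<eta>)))"
            by simp
          also have "\<dots> \<le> (1 + \<delta>) * (expectation (hit_count q i) * expectation (hit_count q j))"
          proof (intro mult_left_mono mult_mono)
            show "u i ^ r * (1 - \<eta>) \<le> expectation (hit_count q i)"
              unfolding u_def using ri ei by (rule expectation_hit_count_ge)
            show "u j ^ r * (1 - \<eta>) \<le> expectation (hit_count q j)"
              unfolding u_def using rj ej by (rule expectation_hit_count_ge)
            show "0 \<le> expectation (hit_count q i)"
              by (rule integral_nonneg_AE) (simp add: hit_count_nonneg)
          qed (use \<delta> u0 \<eta>1 in simp_all)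
          finally show "expectation (\<lambda>\<omega>. hit_count q i \<omega> * hit_count q j \<omega>)
              \<le> (1 + \<delta>) * (expectation (hit_count q i) * expectation (hit_count q j))" .
        qed
      qed
    qed
    show "\<not> summable (\<lambda>i. expectation (hit_count q i))"
    proof
      assume "summable (\<lambda>i. expectation (hit_count q i))"
      then have "summable (\<lambda>i. 2 * expectation (hit_count q i))" by (rule summable_mult)
      moreover have "\<forall>\<^sub>F i in sequentially. norm (u i ^ r) \<le> 2 * expectation (hit_count q i)"
        using half by (rule eventually_mono) (simp add: u0)
      ultimately have "summable (\<lambda>i. u i ^ r)"
        by (rule summable_comparison_test_ev[rotated])
      then show False using expected_hits_not_summable[OF q infinite_sum] unfolding u_def by blast
    qed
  qed
  then show ?thesis
  proof eventually_elim
    case (elim \<omega>)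
    show ?case
      unfolding INFM_nat_le
    proof
      fix m
      obtain i where i: "m \<le> i" "0 < hit_count q i \<omega>"
        using elim unfolding INFM_nat_le by blast
      have "i < 2 ^ i" by (rule less_exp)
      also have "(2::nat) ^ i \<le> scale i" unfolding scale_def by simp
      finally have "m \<le> scale i" using i(1) by simp
      then show "\<exists>n\<ge>m. r \<le> num_events Om n \<omega>"
        using hit_count_pos_imp_many[OF i(2)] by blast
    qed
  qed
qed

end

theorem theorem2p4:
  fixes M :: "'a measure"
    and Om :: "nat \<Rightarrow> nat \<Rightarrow> 'a set"
    and \<rho> \<epsilon> :: "nat \<Rightarrow> real"
    and \<sigma> :: "real \<Rightarrow> real"
    and s sh :: "nat \<Rightarrow> nat"
    and r :: nat
  assumes "prob_space M"
    and "1 \<le> r"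
    and "\<forall>n\<ge>1. 0 < \<rho> n"
    and "antimono_on {1..} \<rho>"
    and "is_event_family M Om"
  shows "(S_sum r \<sigma> \<rho> < \<infinity> \<and> nested_events \<rho> Om \<and>
            almost_indep_fixed_scale M Om \<rho> r \<sigma> \<epsilon> s sh \<longrightarrow>
            (AE \<omega> in M. \<forall>\<^sub>F n in sequentially. num_events Om n \<omega> < r)) \<and>
         (S_sum r \<sigma> \<rho> = \<infinity> \<and>
            almost_indep_all_scales M Om \<rho> r \<sigma> \<epsilon> s sh \<longrightarrow>
            (AE \<omega> in M. \<exists>\<^sub>\<infinity>n. num_events Om n \<omega> \<ge> r))"
proof (intro conjI impI; elim conjE)
  assume S: "S_sum r \<sigma> \<rho> < \<infinity>" and nested: "nested_events \<rho> Om"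
    and indep: "almost_indep_fixed_scale M Om \<rho> r \<sigma> \<epsilon> s sh"
  interpret almost_indep_events M Om \<rho> \<epsilon> \<sigma> s sh r
    by (intro almost_indep_events.intro almost_indep_events_axioms.intro assms indep)
  show "AE \<omega> in M. \<forall>\<^sub>F n in sequentially. num_events Om n \<omega> < r"
    using nested S by (rule eventually_few_events)
next
  assume S: "S_sum r \<sigma> \<rho> = \<infinity>" and indep: "almost_indep_all_scales M Om \<rho> r \<sigma> \<epsilon> s sh"
  then have fixed: "almost_indep_fixed_scale M Om \<rho> r \<sigma> \<epsilon> s sh"
    and M3: "M3 M Om \<rho> \<sigma> \<epsilon> sh r"
    using assms(2) unfolding almost_indep_all_scales_def by simp_all
  interpret almost_indep_events M Om \<rho> \<epsilon> \<sigma> s sh r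
    by (intro almost_indep_events.intro almost_indep_events_axioms.intro assms fixed)
  show "AE \<omega> in M. \<exists>\<^sub>\<infinity>n. num_events Om n \<omega> \<ge> r"
    using M3 S by (rule infinitely_often_many_events)
qed

end
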